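(* Let $(H,W,\mu)$ be an abstract Wiener space and let $X$ be a random variable taking values in $W$. Assume that the law of $X$ is absolutely continuous with respect to $\mu$ with a density $f$ belonging to $\mathcal{L}^p(W,\mu)$ for some $p>1$. Then the expectation $E[X]$ of $X$ belongs to $H$ and coincides with the first kernel $f_1$ in the chaos decomposition of $f$. Moreover, the law of $X-E[X]$ is absolutely continuous with respect to $\mu$, its density is given by $f\diamond\mathcal{E}(-E[X])$, and this density belongs to $\mathcal{L}^q(W,\mu)$ for all $1\le q<p$.
   Context: Abstract Wiener space: $(H,\langle\cdot,\cdot\rangle_H)$ is a separable real Hilbert space continuously and densely embedded in a Banach space $(W,|\cdot|_W)$, and $\mu$ is a Gaussian probability measure on the Borel sets of $W$ such that $\int_W e^{i\langle w,\varphi\rangle}d\mu(w)=e^{-\frac12|\varphi|_H^2}$ for all $\varphi\in W^*$. Here $W^*\subset H$ (dense) is the dual of $W$, $\langle\cdot,\cdot\rangle$ is the dual pairing between $W$ and $W^*$, and $\langle w,\varphi\rangle=\langle w,\varphi\rangle_H$ if $w\in H$, $\varphi\in W^*$. Wiener integral: for $h\in H$, $\delta(h)\in\mathcal{L}^2(W,\mu)$ (also written $\langle w,h\rangle$) is the $\mathcal{L}^2(W,\mu)$-limit of $\langle\cdot,\varphi_j\rangle$ for any sequence $\varphi_j\in W^*$ with $\varphi_j\to h$ in $H$; it is a centered Gaussian variable with variance $|h|_H^2$. Expectation: $E[X]$ is the unique element of $W$ such that $E[\langle X,\varphi\rangle]=\langle E[X],\varphi\rangle$ for all $\varphi\in W^*$.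 Chaos decomposition: every $f\in\mathcal{L}^2(W,\mu)$ has an orthogonal expansion $f=\sum_{k\ge0}\delta^k(f_k)$, where $f_k\in H^{\hat\otimes k}$ (symmetric tensors) and $\delta^k$ is the multiple Itô integral. The first kernel $f_1\in H$ is characterized by $\int_W\delta(\varphi)f\,d\mu=\langle f_1,\varphi\rangle_H$ for all $\varphi\in H$, and this characterization is used as the definition of $f_1$ for $f\in\mathcal{L}^p(W,\mu)$, $p>1$. Wick exponential: for $h\in H$, $\mathcal{E}(h):=\exp^{\diamond}\{\delta(h)\}=\sum_{n\ge0}\frac{\delta(h)^{\diamond n}}{n!}=\exp\{\delta(h)-\tfrac12|h|_H^2\}$, which belongs to $\mathcal{L}^p(W,\mu)$ for all $p\ge1$. Wick product: on multiple Itô integrals, $\delta^k(u_k)\diamond\delta^j(v_j):=\delta^{k+j}(u_k\hat\otimes v_j)$ ($\hat\otimes$ the symmetric tensor product), extended by linearity to finite sums. More generally, for $u,v$ each in some $\mathcal{L}^{r}(W,\mu)$ with $r>1$, $u\diamond v$ denotes the unique element (when it exists) that belongs to $\mathcal{L}^r(W,\mu)$ for some $r>1$ and satisfies $\int_W(u\diamond v)\,\mathcal{E}(h)\,d\mu=\int_W u\,\mathcal{E}(h)\,d\mu\cdot\int_W v\,\mathcal{E}(h)\,d\mu$ for all $h\in H$. Existence of the Wick product appearing in the claim is part of the claim. *)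

theory Defs
  imports "HOL-Probability.Probability"
begin

definition in_Lp :: "'a measure \<Rightarrow> real \<Rightarrow> ('a \<Rightarrow> real) \<Rightarrow> bool" where
  "in_Lp M p u \<longleftrightarrow> u \<in> borel_measurable M \<and> integrable M (\<lambda>x. \<bar>u x\<bar> powr p)"

text \<open>
  The inclusion of \<open>W\<^sup>*\<close> in \<open>H\<close> along the embedding \<open>\<iota> : H \<rightarrow> W\<close>: the functional \<open>\<phi>\<close> is
  identified with the Riesz representative of \<open>\<phi> \<circ> \<iota>\<close>, so that
  \<open>\<langle>\<iota> h, \<phi>\<rangle> = \<langle>h, \<phi>\<rangle>\<^sub>H\<close>.
\<close>

definition dual_emb ::
  "('h::real_inner \<Rightarrow> 'w::real_normed_vector) \<Rightarrow> ('w \<Rightarrow>\<^sub>L real) \<Rightarrow> 'h" where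
  "dual_emb \<iota> \<phi> = (THE k. \<forall>h. blinfun_apply \<phi> (\<iota> h) = inner h k)"

text \<open>
  Separability of \<open>H\<close> is carried by the class \<^class>\<open>polish_space\<close>; separability of \<open>W\<close> then
  follows from the density of the embedding.  The density of \<open>W\<^sup>*\<close> in \<open>H\<close> is not assumed: it
  follows from injectivity of \<open>\<iota>\<close>.
\<close>

locale abstract_wiener_space = prob_space \<mu>
  for \<mu> :: "'w::banach measure" +
  fixes \<iota> :: "'h::{real_inner, polish_space} \<Rightarrow> 'w"
  assumes embedding_bounded_linear: "bounded_linear \<iota>"
    and embedding_inj: "inj \<iota>"
    and embedding_dense: "closure (range \<iota>) = UNIV"
    and sets_borel: "sets \<mu> = sets borel"
    and char_function: "\<And>\<phi> :: 'w \<Rightarrow>\<^sub>L real.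
      (\<integral>w. exp (\<i> * complex_of_real (blinfun_apply \<phi> w)) \<partial>\<mu>)
        = complex_of_real (exp (- (1 / 2) * (norm (dual_emb \<iota> \<phi>))\<^sup>2))"

definition is_wiener_integral ::
  "('h::real_inner \<Rightarrow> 'w::real_normed_vector) \<Rightarrow> 'w measure \<Rightarrow> 'h \<Rightarrow> ('w \<Rightarrow> real) \<Rightarrow> bool" where
  "is_wiener_integral \<iota> \<mu> h D \<longleftrightarrow> in_Lp \<mu> 2 D \<and>
     (\<forall>\<phi> :: nat \<Rightarrow> 'w \<Rightarrow>\<^sub>L real. (\<lambda>j. dual_emb \<iota> (\<phi> j)) \<longlonglongrightarrow> h \<longrightarrow>
        (\<lambda>j. \<integral>w. (blinfun_apply (\<phi> j) w - D w)\<^sup>2 \<partial>\<mu>) \<longlonglongrightarrow> 0)"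

text \<open>A fixed version of the Wiener integral \<open>\<delta>(h)\<close>, which is unique up to \<open>\<mu>\<close>-null sets.\<close>

definition wiener_integral ::
  "('h::real_inner \<Rightarrow> 'w::real_normed_vector) \<Rightarrow> 'w measure \<Rightarrow> 'h \<Rightarrow> 'w \<Rightarrow> real" where
  "wiener_integral \<iota> \<mu> h = (SOME D. is_wiener_integral \<iota> \<mu> h D)"

definition wick_exp ::
  "('h::real_inner \<Rightarrow> 'w::real_normed_vector) \<Rightarrow> 'w measure \<Rightarrow> 'h \<Rightarrow> 'w \<Rightarrow> real" where
  "wick_exp \<iota> \<mu> h = (\<lambda>w. exp (wiener_integral \<iota> \<mu> h w - (1 / 2) * (norm h)\<^sup>2))"

definition is_first_kernel ::
  "('h::real_inner \<Rightarrow> 'w::real_normed_vector) \<Rightarrow> 'w measure \<Rightarrow> ('w \<Rightarrow> real) \<Rightarrow> 'h \<Rightarrow> bool" where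
  "is_first_kernel \<iota> \<mu> f k \<longleftrightarrow>
     (\<forall>h. integrable \<mu> (\<lambda>w. wiener_integral \<iota> \<mu> h w * f w) \<and>
          (\<integral>w. wiener_integral \<iota> \<mu> h w * f w \<partial>\<mu>) = inner k h)"

text \<open>
  The expectation of a \<open>W\<close>-valued random variable is a weak (Pettis) one.  The second
  definition includes the uniqueness, so that it reads ``\<open>E[X]\<close> exists and equals \<open>m\<close>''.
\<close>

definition weak_mean ::
  "'a measure \<Rightarrow> ('a \<Rightarrow> 'w::real_normed_vector) \<Rightarrow> 'w \<Rightarrow> bool" where
  "weak_mean M X m \<longleftrightarrow>
     (\<forall>\<phi> :: 'w \<Rightarrow>\<^sub>L real. integrable M (\<lambda>\<omega>. blinfun_apply \<phi> (X \<omega>)) \<and>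
        (\<integral>\<omega>. blinfun_apply \<phi> (X \<omega>) \<partial>M) = blinfun_apply \<phi> m)"

definition is_expectation ::
  "'a measure \<Rightarrow> ('a \<Rightarrow> 'w::real_normed_vector) \<Rightarrow> 'w \<Rightarrow> bool" where
  "is_expectation M X m \<longleftrightarrow> weak_mean M X m \<and> (\<forall>m'. weak_mean M X m' \<longrightarrow> m' = m)"

text \<open>
  Likewise, \<open>is_wick_product \<iota> \<mu> u v z\<close> states that \<open>u \<diamond> v\<close> exists, is unique
  up to \<open>\<mu>\<close>-null sets, and is represented by \<open>z\<close>.
\<close>

definition wick_candidate ::
  "('h::real_inner \<Rightarrow> 'w::real_normed_vector) \<Rightarrow> 'w measure \<Rightarrow>
     ('w \<Rightarrow> real) \<Rightarrow> ('w \<Rightarrow> real) \<Rightarrow> ('w \<Rightarrow> real) \<Rightarrow> bool" where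
  "wick_candidate \<iota> \<mu> u v z \<longleftrightarrow> (\<exists>r>1. in_Lp \<mu> r z) \<and>
     (\<forall>h. (\<integral>w. z w * wick_exp \<iota> \<mu> h w \<partial>\<mu>)
        = (\<integral>w. u w * wick_exp \<iota> \<mu> h w \<partial>\<mu>) * (\<integral>w. v w * wick_exp \<iota> \<mu> h w \<partial>\<mu>))"

definition is_wick_product ::
  "('h::real_inner \<Rightarrow> 'w::real_normed_vector) \<Rightarrow> 'w measure \<Rightarrow>
     ('w \<Rightarrow> real) \<Rightarrow> ('w \<Rightarrow> real) \<Rightarrow> ('w \<Rightarrow> real) \<Rightarrow> bool" where
  "is_wick_product \<iota> \<mu> u v z \<longleftrightarrow>
     (\<exists>r>1. in_Lp \<mu> r u) \<and> (\<exists>r>1. in_Lp \<mu> r v) \<and> wick_candidate \<iota> \<mu> u v z \<and>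
     (\<forall>z'. wick_candidate \<iota> \<mu> u v z' \<longrightarrow> (AE w in \<mu>. z' w = z w))"

text \<open>
  A real-valued density.  The sign condition is needed because \<^const>\<open>ennreal\<close> truncates
  negative values.
\<close>

definition has_law_density ::
  "'a measure \<Rightarrow> ('a \<Rightarrow> 'w) \<Rightarrow> 'w measure \<Rightarrow> ('w \<Rightarrow> real) \<Rightarrow> bool" where
  "has_law_density M X \<mu> f \<longleftrightarrow>
     distributed M \<mu> X (\<lambda>w. ennreal (f w)) \<and> f \<in> borel_measurable \<mu> \<and> (AE w in \<mu>. 0 \<le> f w)"

end

theory Submission
  imports Defs "HOL-Complex_Analysis.Conformal_Mappings"
begin

text \<open>
  By the Cameron--Martin theorem, the law of \<open>w - \<iota> k\<close> under \<open>\<mu>\<close> has density \<open>\<E>(-k)\<close>.  Hence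
  \<open>X - \<iota> k\<close> has density \<open>g(w) = \<E>(-k)(w) f(w + \<iota> k)\<close>, and the same change of variables together
  with \<open>\<E>(h)(w - \<iota> k) = exp(-\<langle>h, k\<rangle>) \<E>(h)(w)\<close> gives \<open>\<integral> g \<E>(h) = exp(-\<langle>h, k\<rangle>) \<integral> f \<E>(h)\<close>, where
  \<open>exp(-\<langle>h, k\<rangle>) = \<integral> \<E>(-k) \<E>(h)\<close>.  This identifies \<open>g\<close> with \<open>f \<diamond> \<E>(-k)\<close>; the loss from \<open>p\<close> to
  \<open>q < p\<close> is Young's inequality, all moments of \<open>\<E>(-k)\<close> being finite.  The kernel \<open>k = f\<^sub>1\<close> is the
  Riesz representative of \<open>h \<mapsto> \<integral> \<delta>(h) f\<close>, which on \<open>W\<^sup>*\<close> is \<open>\<phi> \<mapsto> E \<langle>X, \<phi>\<rangle>\<close>.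

  Both the Cameron--Martin theorem and the totality of the Wick exponentials reduce to the fact that
  a finite Borel measure on \<open>W\<close> is determined by its characteristic functional: one passes between
  real and imaginary exponents because \<open>z \<mapsto> \<integral> u exp(z Y)\<close> is entire.
\<close>

section \<open>Hahn--Banach and Riesz\<close>

text \<open>As \<open>W\<close> is only a Banach space, everything about its dual rests on
  Hahn--Banach: functionals separate points, which gives uniqueness of the mean and density of the
  dual in \<open>H\<close>, and, \<open>W\<close> being separable, they generate its Borel sets. The
  main obstacle is that \<open>\<delta> h\<close> is a version fixed only up to null sets, so an
  identity for it cannot simply be read off at a translated point. Cameron--Martin is therefore
  proved through the characteristic functional, where only genuine functionals are evaluated at
  shifted points. The absolute continuity it yields then permits shifting almost-everywhere
  statements, and only after that is \<open>\<delta> h\<close> itself translated. The mean is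
  obtained weakly: Riesz produces it inside \<open>H\<close>, so no Bochner integral of
  \<open>X\<close> occurs. The assumption \<open>p > 1\<close> enters through the conjugate exponent
  \<open>p / (p - 1)\<close>: it makes \<open>f\<close> integrable against every exponential of a
  Wiener integral, whence both the boundedness of the kernel functional and the entire
  functions.\<close>

definition sublinear :: "('a::real_vector \<Rightarrow> real) \<Rightarrow> bool" where
  "sublinear q \<longleftrightarrow> (\<forall>x y. q (x + y) \<le> q x + q y) \<and> (\<forall>t x. 0 \<le> t \<longrightarrow> q (t *\<^sub>R x) \<le> t * q x)"

lemma sublinearI:
  assumes "\<And>x y. q (x + y) \<le> q x + q y" "q 0 \<le> 0" "\<And>t x. 0 < t \<Longrightarrow> q (t *\<^sub>R x) \<le> t * q x"
  shows "sublinear q"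
  unfolding sublinear_def
proof (intro conjI allI impI)
  show "q (t *\<^sub>R x) \<le> t * q x" if "0 \<le> t" for t x
    using assms(2) assms(3)[of t x] that by (cases "t = 0") auto
qed (use assms in auto)

lemma sublinear_add: "sublinear q \<Longrightarrow> q (x + y) \<le> q x + q y"
  by (auto simp: sublinear_def)

lemma sublinear_zero: "sublinear q \<Longrightarrow> q 0 = 0"
  unfolding sublinear_def by (metis add_cancel_right_left le_add_same_cancel1 mult_zero_left order_antisym order_refl scale_zero_left)

lemma sublinear_scale:
  assumes "sublinear q" "0 \<le> t"
  shows "q (t *\<^sub>R x) = t * q x"
proof (cases "t = 0")
  case False
  then have t: "t > 0" using assms by simp
  have "q ((1/t) *\<^sub>R (t *\<^sub>R x)) \<le> (1/t) * q (t *\<^sub>R x)"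
    using assms t unfolding sublinear_def by (metis divide_nonneg_nonneg zero_le_one)
  then have "t * q x \<le> q (t *\<^sub>R x)"
    using t by (simp add: field_simps)
  then show ?thesis using assms by (auto simp: sublinear_def intro: antisym)
qed (simp add: sublinear_zero[OF assms(1)])

lemma sublinear_minus: "sublinear q \<Longrightarrow> - q (- x) \<le> q x"
  using sublinear_add[of q x "-x"] sublinear_zero[of q] by simp

text \<open>
  A minimal sublinear functional cannot be tightened at any point, so it is odd, hence linear.
\<close>

lemma sublinear_tighten:
  fixes q :: "'a::real_vector \<Rightarrow> real"
  assumes q: "sublinear q"
  obtains r where "sublinear r" "\<And>x. r x \<le> q x" "r (- x0) \<le> - q x0"
proof -
  \<comment> \<open>The infimum over \<open>t\<close> forces the value at \<open>- x0\<close> down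
    while keeping sublinearity: \<open>t = 0\<close> gives \<open>r \<le> q\<close>, and
    \<open>t = 1\<close> at \<open>- x0\<close> gives \<open>q 0 - q x0\<close>. Subadditivity of
    \<open>q\<close> keeps the infimum above \<open>- q (- x)\<close>.\<close>
  define F where "F x t = q (x + t *\<^sub>R x0) - t * q x0" for x t
  define r where "r x = (INF t\<in>{0..}. F x t)" for x
  have lb: "- q (- x) \<le> F x t" if "0 \<le> t" for x t
    using sublinear_add[OF q, of "x + t *\<^sub>R x0" "- x"] sublinear_scale[OF q that, of x0]
    by (simp add: F_def)
  have bdd: "bdd_below (F x ` {0..})" for x
    by (rule bdd_belowI[of _ "- q (- x)"]) (auto intro: lb)
  have r_le: "r x \<le> F x t" if "0 \<le> t" for x t
    unfolding r_def using that by (intro cINF_lower bdd) auto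
  have r_ge: "c \<le> r x" if "\<And>t. 0 \<le> t \<Longrightarrow> c \<le> F x t" for x c
    unfolding r_def using that by (intro cINF_greatest) auto
  show thesis
  proof
    show "sublinear r"
    proof (rule sublinearI)
      fix x y
      have "r (x + y) \<le> F x s + F y t" if "0 \<le> s" "0 \<le> t" for s t
      proof -
        have "r (x + y) \<le> F (x + y) (s + t)" using that by (intro r_le) auto
        also have "\<dots> \<le> F x s + F y t"
          using sublinear_add[OF q, of "x + s *\<^sub>R x0" "y + t *\<^sub>R x0"]
          by (simp add: F_def algebra_simps)
        finally show ?thesis .
      qed
      then have "r (x + y) - F x s \<le> r y" if "0 \<le> s" for s
        using that by (intro r_ge) (simp add: algebra_simps)
      then have "r (x + y) - r y \<le> r x"
        by (intro r_ge) (simp add: algebra_simps)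
      then show "r (x + y) \<le> r x + r y" by simp
    next
      show "r 0 \<le> 0" using r_le[of 0 0] sublinear_zero[OF q] by (simp add: F_def)
    next
      fix c :: real and x assume c: "0 < c"
      have "r (c *\<^sub>R x) / c \<le> r x"
      proof (rule r_ge)
        fix t :: real assume t: "0 \<le> t"
        have "r (c *\<^sub>R x) \<le> F (c *\<^sub>R x) (c * t)" using c t by (intro r_le) auto
        also have "\<dots> = c * F x t"
          using sublinear_scale[OF q, of c "x + t *\<^sub>R x0"] c by (simp add: F_def algebra_simps)
        finally show "r (c *\<^sub>R x) / c \<le> F x t" using c by (simp add: field_simps)
      qed
      then show "r (c *\<^sub>R x) \<le> c * r x" using c by (simp add: field_simps)
    qed
    show "r x \<le> q x" for x using r_le[of 0 x] by (simp add: F_def)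
    show "r (- x0) \<le> - q x0" using r_le[of 1 "-x0"] sublinear_zero[OF q] by (simp add: F_def)
  qed
qed

text \<open>Zorn's lemma for the pointwise order. The infimum of a chain is finite because every
  sublinear functional below \<open>p\<close> stays above \<open>- p (- x)\<close>.\<close>

lemma sublinear_minimal:
  fixes p :: "'a::real_vector \<Rightarrow> real"
  assumes p: "sublinear p"
  obtains m where "sublinear m" "\<And>x. m x \<le> p x"
    "\<And>r. sublinear r \<Longrightarrow> (\<And>x. r x \<le> m x) \<Longrightarrow> r = m"
proof -
  define A where "A = {q. sublinear q \<and> (\<forall>x. q x \<le> p x)}"
  \<comment> \<open>The order is reversed, so the upper bounds and maximal elements of Zorn's lemma
    are lower bounds and minimal functionals.\<close>
  define P where "P q r \<longleftrightarrow> (\<forall>x. r x \<le> q x)" for q r :: "'a \<Rightarrow> real"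
  have "\<exists>m\<in>A. \<forall>a\<in>A. P m a \<longrightarrow> a = m"
  proof (rule predicate_Zorn)
    show "partial_order_on A (relation_of P A)"
      by (rule partial_order_on_relation_ofI) (auto simp: P_def fun_eq_iff intro: order_trans antisym)
  next
    fix C assume C: "C \<in> Chains (relation_of P A)"
    show "\<exists>u\<in>A. \<forall>a\<in>C. P a u"
    proof (cases "C = {}")
      case True
      then show ?thesis using p by (auto simp: A_def)
    next
      case False
      have CA: "q \<in> A" if "q \<in> C" for q
        using C that by (auto simp: Chains_def relation_of_def)
      have chain: "P q r \<or> P r q" if "q \<in> C" "r \<in> C" for q r
        using C that by (auto simp: Chains_def relation_of_def)
      define u where "u x = (INF q\<in>C. q x)" for x
      have bdd: "bdd_below ((\<lambda>q. q x) ` C)" for x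
      proof (rule bdd_belowI[of _ "- p (- x)"])
        fix y assume "y \<in> (\<lambda>q. q x) ` C"
        then obtain q where q: "q \<in> A" "y = q x" using CA by auto
        then have "- q (- x) \<le> q x" "q (- x) \<le> p (- x)"
          by (auto simp: A_def sublinear_minus)
        then show "- p (- x) \<le> y" using q by simp
      qed
      have u_le: "u x \<le> q x" if "q \<in> C" for q x
        unfolding u_def using that by (intro cINF_lower bdd)
      have u_ge: "c \<le> u x" if "\<And>q. q \<in> C \<Longrightarrow> c \<le> q x" for c x
        unfolding u_def using that False by (intro cINF_greatest)
      have sub: "sublinear q" "q x \<le> p x" if "q \<in> C" for q x
        using CA[OF that] by (auto simp: A_def)
      have "sublinear u"
      proof (rule sublinearI)
        fix x y
        have "u (x + y) \<le> q x + r y" if qr: "q \<in> C" "r \<in> C" for q r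
        proof -
          \<comment> \<open>An infimum of sublinear functionals need not be subadditive; in a chain
            it is, since the smaller of \<open>q\<close> and \<open>r\<close> serves at both
            points.\<close>
          obtain s where s: "s \<in> C" "s x \<le> q x" "s y \<le> r y"
            using chain[OF qr] qr by (auto simp: P_def)
          have "u (x + y) \<le> s (x + y)" by (rule u_le) fact
          also have "\<dots> \<le> s x + s y" by (rule sublinear_add) (rule sub, fact)
          finally show ?thesis using s by simp
        qed
        then have "u (x + y) - q x \<le> r y" if "q \<in> C" "r \<in> C" for q r
          using that by (simp only: diff_le_eq add.commute[of "r y"])
        then have "u (x + y) - q x \<le> u y" if "q \<in> C" for q
          using that by (intro u_ge)
        then have "u (x + y) - u y \<le> u x"
          by (intro u_ge) (simp add: algebra_simps)
        then show "u (x + y) \<le> u x + u y" by simp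
      next
        obtain q where "q \<in> C" using False by auto
        then show "u 0 \<le> 0" using u_le[of q 0] sublinear_zero[OF sub(1)[of q]] by simp
      next
        fix c :: real and x assume c: "0 < c"
        have "u (c *\<^sub>R x) / c \<le> u x"
        proof (rule u_ge)
          fix q assume q: "q \<in> C"
          have "u (c *\<^sub>R x) \<le> q (c *\<^sub>R x)" by (rule u_le) fact
          also have "\<dots> = c * q x" using c by (intro sublinear_scale sub q) auto
          finally show "u (c *\<^sub>R x) / c \<le> q x" using c by (simp add: field_simps)
        qed
        then show "u (c *\<^sub>R x) \<le> c * u x" using c by (simp add: field_simps)
      qed
      moreover have "u x \<le> p x" for x
      proof -
        obtain q where "q \<in> C" using False by auto
        then show ?thesis using u_le[of q x] sub(2)[of q x] by simp
      qed
      ultimately have "u \<in> A" by (auto simp: A_def)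
      then show ?thesis using u_le by (auto simp: P_def)
    qed
  qed
  then obtain m where m: "m \<in> A" "\<And>a. a \<in> A \<Longrightarrow> P m a \<Longrightarrow> a = m" by auto
  show thesis
  proof
    show "sublinear m" "m x \<le> p x" for x using m(1) by (auto simp: A_def)
    show "r = m" if "sublinear r" "\<And>x. r x \<le> m x" for r
    proof (rule m(2))
      show "r \<in> A" using that m(1) by (auto simp: A_def intro: order_trans)
      show "P m r" using that by (auto simp: P_def)
    qed
  qed
qed

text \<open>Tightening at \<open>x0\<close> comes before minimising: everything below
  \<open>p'\<close> has value at most \<open>- p x0\<close> at \<open>- x0\<close>, and once the
  minimal functional is known to be odd this says that it attains \<open>p x0\<close>. No extension
  from a subspace is needed. Additivity follows from oddness by using subadditivity at
  \<open>x\<close>, \<open>y\<close> and at their negatives.\<close>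

theorem Hahn_Banach_sublinear:
  fixes p :: "'a::real_vector \<Rightarrow> real"
  assumes p: "sublinear p"
  obtains L where "linear L" "\<And>x. L x \<le> p x" "L x0 = p x0"
proof -
  obtain p' where p': "sublinear p'" "\<And>x. p' x \<le> p x" "p' (- x0) \<le> - p x0"
    using sublinear_tighten[OF p, of x0] by blast
  obtain m where m: "sublinear m" "\<And>x. m x \<le> p' x"
    "\<And>r. sublinear r \<Longrightarrow> (\<And>x. r x \<le> m x) \<Longrightarrow> r = m"
    using sublinear_minimal[OF p'(1)] by blast
  have odd: "m (- x) = - m x" for x
  proof (rule antisym)
    obtain r where r: "sublinear r" "\<And>y. r y \<le> m y" "r (- x) \<le> - m x"
      using sublinear_tighten[OF m(1), of x] by blast
    then show "m (- x) \<le> - m x" using m(3)[OF r(1,2)] by simp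
    show "- m x \<le> m (- x)" using sublinear_minus[OF m(1), of "-x"] by simp
  qed
  show thesis
  proof
    show "linear m"
    proof (rule linearI)
      fix x y
      have "m (x + y) \<le> m x + m y" "m (- x + - y) \<le> m (- x) + m (- y)"
        by (rule sublinear_add[OF m(1)])+
      moreover have "m (- x + - y) = - m (x + y)" using odd[of "x + y"] by simp
      ultimately show "m (x + y) = m x + m y" using odd[of x] odd[of y] by simp
    next
      fix c x
      show "m (c *\<^sub>R x) = c *\<^sub>R m x"
      proof (cases "0 \<le> c")
        case False
        then have "m ((- c) *\<^sub>R x) = (- c) * m x" by (intro sublinear_scale m) auto
        then show ?thesis using odd[of "c *\<^sub>R x"] by simp
      qed (simp add: sublinear_scale[OF m(1)])
    qed
    show "m x \<le> p x" for x using m(2)[of x] p'(2)[of x] by simp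
    show "m x0 = p x0"
    proof (rule antisym)
      show "m x0 \<le> p x0" using m(2)[of x0] p'(2)[of x0] by simp
      show "p x0 \<le> m x0" using m(2)[of "-x0"] p'(3) odd[of x0] by simp
    qed
  qed
qed

lemma norming_functional:
  fixes x :: "'a::real_normed_vector"
  obtains \<phi> :: "'a \<Rightarrow>\<^sub>L real" where "\<And>y. \<bar>blinfun_apply \<phi> y\<bar> \<le> norm y" "blinfun_apply \<phi> x = norm x"
proof -
  have "sublinear (norm :: 'a \<Rightarrow> real)"
    by (rule sublinearI) (auto intro: norm_triangle_ineq)
  then obtain L :: "'a \<Rightarrow> real" where L: "linear L" "\<And>y. L y \<le> norm y" "L x = norm x"
    using Hahn_Banach_sublinear[of norm x] by blast
  have abs: "\<bar>L y\<bar> \<le> norm y" for y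
    using L(2)[of y] L(2)[of "-y"] linear_neg[OF L(1), of y] by simp
  have bl: "bounded_linear L"
    by (intro bounded_linear_intro[where K = 1])
       (use abs L(1) in \<open>auto simp: linear_add linear_scale\<close>)
  show thesis
    by (rule that[of "Blinfun L"]) (use abs L bl in \<open>auto simp: bounded_linear_Blinfun_apply\<close>)
qed

lemma blinfun_eq_on_imp_eq:
  fixes x y :: "'a::real_normed_vector"
  assumes "\<And>\<phi> :: 'a \<Rightarrow>\<^sub>L real. blinfun_apply \<phi> x = blinfun_apply \<phi> y"
  shows "x = y"
proof -
  obtain \<phi> :: "'a \<Rightarrow>\<^sub>L real" where "blinfun_apply \<phi> (x - y) = norm (x - y)"
    using norming_functional[of "x - y"] by blast
  then show ?thesis using assms[of \<phi>] by (simp add: blinfun.diff_right)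
qed

text \<open>Hahn--Banach with the distance to \<open>S\<close> as dominating functional. It vanishes
  on \<open>S\<close>, so \<open>L\<close> is nonpositive there and, \<open>S\<close> being
  symmetric, zero; at \<open>x\<close> the distance is positive.\<close>

lemma subspace_functional:
  fixes S :: "'a::real_normed_vector set"
  assumes S: "subspace S" and x: "x \<notin> closure S"
  obtains L where "bounded_linear L" "\<And>s. s \<in> S \<Longrightarrow> L s = 0" "L x \<noteq> (0::real)"
proof -
  have ne: "S \<noteq> {}" using subspace_0[OF S] by auto
  define p where "p y = infdist y S" for y
  have p_le: "p y \<le> norm (y - s)" if "s \<in> S" for y s
    using infdist_le[OF that, of y] by (simp add: p_def dist_norm)
  have p_ge: "c \<le> p y" if "\<And>s. s \<in> S \<Longrightarrow> c \<le> norm (y - s)" for c y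
    unfolding p_def infdist_notempty[OF ne] dist_norm using that ne by (intro cINF_greatest) auto
  have p0: "p 0 \<le> 0" using p_le[OF subspace_0[OF S], of 0] by simp
  have "sublinear p"
  proof (rule sublinearI)
    fix y z
    have "p (y + z) \<le> norm (y - s) + norm (z - t)" if "s \<in> S" "t \<in> S" for s t
      using p_le[OF subspace_add[OF S that], of "y + z"] norm_triangle_ineq[of "y - s" "z - t"]
      by (simp add: algebra_simps)
    then have "p (y + z) - norm (y - s) \<le> p z" if "s \<in> S" for s
      using that by (intro p_ge) (simp add: algebra_simps)
    then have "p (y + z) - p z \<le> p y"
      by (intro p_ge) (simp add: algebra_simps)
    then show "p (y + z) \<le> p y + p z" by simp
  next
    fix t :: real and y assume t: "0 < t"
    have "p (t *\<^sub>R y) / t \<le> p y"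
    proof (rule p_ge)
      fix s assume "s \<in> S"
      then have "p (t *\<^sub>R y) \<le> norm (t *\<^sub>R y - t *\<^sub>R s)"
        by (intro p_le subspace_scale[OF S])
      also have "\<dots> = t * norm (y - s)"
        using t by (simp flip: scaleR_diff_right)
      finally show "p (t *\<^sub>R y) / t \<le> norm (y - s)" using t by (simp add: field_simps)
    qed
    then show "p (t *\<^sub>R y) \<le> t * p y" using t by (simp add: field_simps)
  qed (fact p0)
  then obtain L where L: "linear L" "\<And>y. L y \<le> p y" "L x = p x"
    using Hahn_Banach_sublinear[of p x] by blast
  have le: "L y \<le> norm y" for y
    using L(2)[of y] p_le[OF subspace_0[OF S], of y] by simp
  have abs: "\<bar>L y\<bar> \<le> norm y" for y
    using le[of y] le[of "-y"] linear_neg[OF L(1), of y] by simp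
  have bl: "bounded_linear L"
    by (intro bounded_linear_intro[where K = 1])
       (use abs L(1) in \<open>auto simp: linear_add linear_scale\<close>)
  moreover have "L s = 0" if "s \<in> S" for s
  proof -
    have "L s \<le> 0" "L (- s) \<le> 0"
      using L(2)[of s] L(2)[of "-s"] p_le[OF that, of s] p_le[OF subspace_neg[OF S that], of "-s"]
      by auto
    then show ?thesis using linear_neg[OF L(1), of s] by simp
  qed
  moreover have "p x \<noteq> 0"
    using x in_closure_iff_infdist_zero[OF ne] by (simp add: p_def)
  ultimately show thesis using L(3) that by auto
qed

theorem Riesz_representation:
  fixes F :: "'h::{real_inner, complete_space} \<Rightarrow> real"
  assumes F: "bounded_linear F"
  shows "\<exists>!k. \<forall>h. F h = inner h k"
proof (rule ex_ex1I)
  interpret F: bounded_linear F by fact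
  obtain C where C: "\<And>x. \<bar>F x\<bar> \<le> norm x * C" using F.bounded by auto
  \<comment> \<open>The representative is the minimiser of \<open>J\<close>.\<close>
  define J where "J h = (norm h)\<^sup>2 - 2 * F h" for h
  have Jlb: "- C\<^sup>2 \<le> J h" for h
  proof -
    have "0 \<le> (norm h - C)\<^sup>2" by simp
    then show ?thesis using C[of h] by (simp add: J_def power2_eq_square algebra_simps)
  qed
  define I where "I = (INF h. J h)"
  have bdd: "bdd_below (range J)" by (rule bdd_belowI[of _ "- C\<^sup>2"]) (auto intro: Jlb)
  have I_le: "I \<le> J h" for h unfolding I_def by (rule cINF_lower[OF bdd]) auto
  have "\<exists>h. J h < I + 1 / real (Suc n)" for n
    using cINF_less_iff[OF _ bdd, of "I + 1 / real (Suc n)"] by (auto simp: I_def)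
  then obtain s where s: "\<And>n. J (s n) < I + 1 / real (Suc n)" by metis
  \<comment> \<open>The linear part of \<open>J\<close> cancels in the parallelogram law. Since the
    midpoint has value at least \<open>I\<close>, two almost-minimisers must be close, which makes
    the minimising sequence Cauchy.\<close>
  have par: "(norm (a - b))\<^sup>2 = 2 * J a + 2 * J b - 4 * J ((1/2) *\<^sub>R (a + b))" for a b
    by (simp add: J_def F.add F.scaleR F.diff power2_norm_eq_inner inner_diff_left inner_diff_right
        inner_add_left inner_add_right inner_commute algebra_simps)
  have diff: "(norm (s m - s n))\<^sup>2 \<le> 2 / real (Suc m) + 2 / real (Suc n)" for m n
    using par[of "s m" "s n"] s[of m] s[of n] I_le[of "(1/2) *\<^sub>R (s m + s n)"] by simp
  have "Cauchy s"
  proof (rule metric_CauchyI)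
    fix e :: real assume e: "0 < e"
    obtain N where N: "real N > 4 / e\<^sup>2" using reals_Archimedean2 by blast
    have "dist (s m) (s n) < e" if mn: "m \<ge> N" "n \<ge> N" for m n
    proof -
      have "0 < 4 / e\<^sup>2" using e by simp
      then have pos: "0 < real N" using N by linarith
      have "(norm (s m - s n))\<^sup>2 \<le> 2 / real (Suc m) + 2 / real (Suc n)" by (rule diff)
      also have "\<dots> \<le> 2 / real N + 2 / real N"
        using mn pos by (intro add_mono divide_left_mono mult_pos_pos) auto
      also have "\<dots> < e\<^sup>2" using N pos e by (simp add: field_simps)
      finally show ?thesis using e by (simp add: dist_norm power_less_imp_less_base)
    qed
    then show "\<exists>M. \<forall>m\<ge>M. \<forall>n\<ge>M. dist (s m) (s n) < e" by blast
  qed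
  then obtain k where k: "s \<longlonglongrightarrow> k" using Cauchy_convergent convergentD by blast
  have "(\<lambda>n. J (s n)) \<longlonglongrightarrow> J k"
    unfolding J_def by (intro tendsto_intros k F.tendsto)
  moreover have "(\<lambda>n. I + 1 / real (Suc n)) \<longlonglongrightarrow> I + 0"
    by (intro tendsto_add tendsto_const LIMSEQ_inverse_real_of_nat[unfolded inverse_eq_divide])
  ultimately have "J k \<le> I + 0"
    using s by (intro LIMSEQ_le) (auto intro: less_imp_le)
  then have min: "J k \<le> J h" for h using I_le[of h] by simp
  show "\<exists>k. \<forall>h. F h = inner h k"
  proof (intro exI allI)
    fix h
    have "(norm (k + t *\<^sub>R h))\<^sup>2 = (norm k)\<^sup>2 + 2 * t * inner h k + t\<^sup>2 * (norm h)\<^sup>2" for t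
      by (simp add: power2_norm_eq_inner inner_simps inner_commute[of k h] algebra_simps
          power2_eq_square[of t])
    then have *: "0 \<le> 2 * t * (inner h k - F h) + t\<^sup>2 * (norm h)\<^sup>2" for t
      using min[of "k + t *\<^sub>R h"] by (simp add: J_def F.add F.scaleR algebra_simps)
    define d where "d = inner h k - F h"
    \<comment> \<open>The best step along \<open>h\<close> would divide by the squared norm of
      \<open>h\<close>. Adding \<open>1\<close> keeps the denominator positive also for
      \<open>h = 0\<close>, and the weaker bound still forces \<open>d = 0\<close>.\<close>
    define a where "a = (norm h)\<^sup>2 + 1"
    have a: "a > 0" by (simp add: a_def add_nonneg_pos)
    have "0 \<le> 2 * (- d / a) * d + (- d / a)\<^sup>2 * (norm h)\<^sup>2"
      using *[of "- d / a"] by (simp add: d_def)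
    also have "\<dots> \<le> 2 * (- d / a) * d + (- d / a)\<^sup>2 * a"
      by (intro add_left_mono mult_left_mono) (auto simp: a_def)
    also have "\<dots> = - (d\<^sup>2 / a)" using a by (simp add: power2_eq_square field_simps)
    finally have "d\<^sup>2 \<le> 0" using a by (simp add: divide_le_0_iff)
    then show "F h = inner h k" by (simp add: d_def)
  qed
next
  fix k k' assume "\<forall>h. F h = inner h k" "\<forall>h. F h = inner h k'"
  then have "inner (k - k') (k - k') = 0" by (simp add: inner_diff_right)
  then show "k = k'" by simp
qed

section \<open>Finite measures are determined by their characteristic functional\<close>

text \<open>The value at \<open>t = 0\<close> shows that the total masses agree, so both laws are
  normalised by the same constant and \<open>Levy_uniqueness\<close> applies. Mass zero cannot be
  normalised and is treated apart.\<close>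

lemma Levy_uniqueness_finite:
  assumes "finite_measure N1" "finite_measure N2"
    and [measurable]: "Y1 \<in> borel_measurable N1" "Y2 \<in> borel_measurable N2"
    and char: "\<And>t. (\<integral>x. iexp (t * Y1 x) \<partial>N1) = (\<integral>x. iexp (t * Y2 x) \<partial>N2)"
  shows "distr N1 borel Y1 = distr N2 borel Y2"
proof -
  interpret N1: finite_measure N1 by fact
  interpret N2: finite_measure N2 by fact
  define m where "m = measure N1 (space N1)"
  have m2: "measure N2 (space N2) = m"
    using char[of 0] by (simp add: m_def)
  have emeasure_space: "emeasure N1 (space N1) = m" "emeasure N2 (space N2) = m"
    using m2 by (simp_all add: m_def N1.emeasure_eq_measure N2.emeasure_eq_measure)
  show ?thesis
  proof (cases "m = 0")
    case True
    have "emeasure N1 A = 0" "emeasure N2 B = 0" for A B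
      using emeasure_space Measure_Space.emeasure_space[of N1 A] Measure_Space.emeasure_space[of N2 B] True by auto
    then show ?thesis by (intro measure_eqI) (simp_all add: emeasure_distr)
  next
    case False
    then have m: "0 < m" by (simp add: m_def zero_less_measure_iff)
    define S where "S D = density D (\<lambda>_. ennreal (1 / m))" for D :: "real measure"
    have emeasure_S: "emeasure (S D) A = ennreal (1 / m) * emeasure D A" if "sets D = sets borel" "A \<in> sets borel" for D A
      using that by (simp add: S_def emeasure_density_const)
    have real_distr: "real_distribution (S D)" if "sets D = sets borel" "emeasure D (space D) = m" for D
    proof -
      have "prob_space (S D)"
      proof (rule prob_spaceI)
        have "space D = UNIV" using sets_eq_imp_space_eq[OF that(1)] by simp
        then show "emeasure (S D) (space (S D)) = 1"
          using emeasure_S[OF that(1), of UNIV] that(2) m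
          by (simp add: S_def ennreal_mult''[symmetric])
      qed
      then show ?thesis
        using that(1) by (simp add: real_distribution_def real_distribution_axioms_def S_def)
    qed
    have "S (distr N1 borel Y1) = S (distr N2 borel Y2)"
    proof (rule Levy_uniqueness)
      show "char (S (distr N1 borel Y1)) = char (S (distr N2 borel Y2))"
        unfolding fun_eq_iff by (simp add: S_def char_def integral_density integral_distr m less_imp_le char
          del: of_real_mult)
    qed (auto intro!: real_distr simp: emeasure_distr emeasure_space)
    then have eq: "ennreal (1 / m) * emeasure (distr N1 borel Y1) A = ennreal (1 / m) * emeasure (distr N2 borel Y2) A"
      if "A \<in> sets borel" for A
      using that emeasure_S by (metis sets_distr)
    show ?thesis
      using eq m by (intro measure_eqI) (auto simp: ennreal_mult_cancel_left)
  qed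
qed

text \<open>The weight \<open>u\<close> is absorbed into the measures as a density. This allows one
  coordinate to be treated while the other factors of an integrand are frozen.\<close>

lemma weighted_Levy_uniqueness:
  fixes u :: "'w \<Rightarrow> real"
  assumes "finite_measure N1" "finite_measure N2"
    and u: "integrable N1 u" "integrable N2 u" "\<And>x. 0 \<le> u x"
    and Y: "Y \<in> borel_measurable N1" "Y \<in> borel_measurable N2"
    and char: "\<And>t. (\<integral>x. u x * iexp (t * Y x) \<partial>N1) = (\<integral>x. u x * iexp (t * Y x) \<partial>N2)"
    and A: "A \<in> sets borel"
  shows "(\<integral>x. u x * indicator A (Y x) \<partial>N1) = (\<integral>x. u x * indicator A (Y x) \<partial>N2)"
proof -
  define D where "D N = density N (\<lambda>x. ennreal (u x))" for N
  have fin: "finite_measure (D N)" if "integrable N u" for N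
    using that u(3)
    by (intro finite_measureI)
       (auto simp: D_def emeasure_density nn_integral_eq_integral cong: nn_integral_cong)
  have int: "(\<integral>x. f (Y x) \<partial>(D N)) = (\<integral>x. u x *\<^sub>R f (Y x) \<partial>N)"
    if "integrable N u" "Y \<in> borel_measurable N" "f \<in> borel_measurable borel"
    for f :: "real \<Rightarrow> 'b::{banach, second_countable_topology}" and N
    unfolding D_def using that u(3) by (intro integral_density) (auto intro: measurable_compose)
  have "distr (D N1) borel Y = distr (D N2) borel Y"
  proof (rule Levy_uniqueness_finite)
    show "(\<integral>x. iexp (t * Y x) \<partial>(D N1)) = (\<integral>x. iexp (t * Y x) \<partial>(D N2))" for t
      using int[OF u(1) Y(1), of "\<lambda>y. iexp (t * y)"] int[OF u(2) Y(2), of "\<lambda>y. iexp (t * y)"] char[of t]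
      by (simp add: scaleR_conv_of_real)
  qed (use fin u Y in \<open>auto simp: D_def\<close>)
  then have "(\<integral>x. (indicator A x :: real) \<partial>(distr (D N1) borel Y)) = (\<integral>x. (indicator A x :: real) \<partial>(distr (D N2) borel Y))"
    by simp
  then have "(\<integral>x. (indicator A (Y x) :: real) \<partial>(D N1)) = (\<integral>x. (indicator A (Y x) :: real) \<partial>(D N2))"
    using A Y by (subst (asm) (1 2) integral_distr) (auto simp: D_def)
  then show ?thesis
    using int[OF u(1) Y(1), of "indicator A :: real \<Rightarrow> real"]
      int[OF u(2) Y(2), of "indicator A :: real \<Rightarrow> real"] A
    by simp
qed

section \<open>Cylinder sets and the Borel sigma-algebra\<close>

text \<open>Constraints form a list so that induction adds one at a time, intersection is
  concatenation and the empty list gives the whole space.\<close>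

definition cylinder :: "(('w::real_normed_vector \<Rightarrow>\<^sub>L real) \<times> real set) list \<Rightarrow> 'w set" where
  "cylinder xs = {w. \<forall>(\<phi>, A)\<in>set xs. blinfun_apply \<phi> w \<in> A}"

definition cylinders :: "'w::real_normed_vector set set" where
  "cylinders = cylinder ` {xs. \<forall>(\<phi>, A)\<in>set xs. A \<in> sets borel}"

lemma borel_measurable_blinfun_apply [measurable]:
  "blinfun_apply \<phi> \<in> borel_measurable borel"
  by (intro borel_measurable_continuous_onI continuous_intros)

lemma cylinder_borel:
  assumes "\<And>\<phi> A. (\<phi>, A) \<in> set xs \<Longrightarrow> A \<in> sets borel"
  shows "cylinder xs \<in> sets borel"
proof -
  have "{w. blinfun_apply \<phi> w \<in> A} \<in> sets borel" if "(\<phi>, A) \<in> set xs" for \<phi> A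
    using measurable_sets[OF borel_measurable_blinfun_apply assms[OF that], of \<phi>]
    by (simp add: vimage_def)
  moreover have "cylinder xs = (\<Inter>y\<in>set xs. {w. blinfun_apply (fst y) w \<in> snd y})"
    by (force simp: cylinder_def)
  ultimately show ?thesis
    by (cases "xs = []") (auto intro!: sets.finite_INT)
qed

text \<open>The norming functionals of a countable dense set suffice to recover the norm, so a
  closed ball is a countable intersection of half-spaces. By separability, open sets are countable
  unions of such balls.\<close>

lemma sigma_sets_cylinders:
  fixes D :: "'w::real_normed_vector set"
  assumes D: "countable D" "closure D = UNIV"
  shows "sigma_sets UNIV (cylinders :: 'w set set) = sets borel"
proof
  show "sigma_sets UNIV (cylinders :: 'w set set) \<subseteq> sets borel"
    using sets.sigma_sets_subset[of cylinders "borel :: 'w measure"]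
    by (force simp: cylinders_def intro!: cylinder_borel)
next
  define S where "S = sigma UNIV (cylinders :: 'w set set)"
  have sets_S: "sets S = sigma_sets UNIV cylinders" "space S = UNIV"
    by (auto simp: S_def)
  obtain \<psi> :: "'w \<Rightarrow> 'w \<Rightarrow>\<^sub>L real" where \<psi>: "\<And>v y. \<bar>blinfun_apply (\<psi> v) y\<bar> \<le> norm y"
    "\<And>v. blinfun_apply (\<psi> v) v = norm v"
    using norming_functional by metis
  have dense: "\<exists>d\<in>D. dist x d < e" if "0 < e" for x e
    using D(2) that closure_approachable[of x D] by (auto simp: dist_commute)
  have halfspace: "{w. blinfun_apply \<phi> w \<le> c} \<in> sets S" for \<phi> :: "'w \<Rightarrow>\<^sub>L real" and c
  proof -
    have "{w. blinfun_apply \<phi> w \<le> c} = cylinder [(\<phi>, {..c})]" by (simp add: cylinder_def)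
    then show ?thesis unfolding sets_S by (auto simp: cylinders_def intro!: sigma_sets.Basic)
  qed
  have cball: "cball d r \<in> sets S" for d r
  proof -
    have "cball d r = (\<Inter>v\<in>D. {w. blinfun_apply (\<psi> v) w \<le> r + blinfun_apply (\<psi> v) d})"
    proof (intro equalityI subsetI)
      fix w assume "w \<in> cball d r"
      then show "w \<in> (\<Inter>v\<in>D. {w. blinfun_apply (\<psi> v) w \<le> r + blinfun_apply (\<psi> v) d})"
        using \<psi>(1)[of _ "w - d"] by (auto simp: dist_norm norm_minus_commute blinfun.diff_right abs_le_iff)
          (metis add.commute diff_le_eq order_trans)
    next
      fix w assume w: "w \<in> (\<Inter>v\<in>D. {w. blinfun_apply (\<psi> v) w \<le> r + blinfun_apply (\<psi> v) d})"
      have "norm (w - d) \<le> r + e" if e: "0 < e" for e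
      proof -
        \<comment> \<open>The norming functional of \<open>v\<close> almost norms
          \<open>w - d\<close>: replacing \<open>w - d\<close> by \<open>v\<close> costs at most
          \<open>e / 2\<close> in the norm and \<open>e / 2\<close> in the functional.\<close>
        obtain v where v: "v \<in> D" "dist (w - d) v < e / 2" using dense[of "e / 2" "w - d"] e by auto
        have "norm (w - d) \<le> norm v + norm (w - d - v)" using norm_triangle_ineq[of v "w - d - v"] by simp
        also have "norm v = blinfun_apply (\<psi> v) (w - d) - blinfun_apply (\<psi> v) (w - d - v)"
          by (simp add: blinfun.diff_right \<psi>(2))
        also have "\<dots> \<le> r + norm (w - d - v)"
          using w v(1) \<psi>(1)[of v "w - d - v"] by (auto simp: blinfun.diff_right abs_le_iff)
        finally show ?thesis using v(2) by (simp add: dist_norm)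
      qed
      then have "norm (w - d) \<le> r" by (rule field_le_epsilon)
      then show "w \<in> cball d r" by (simp add: dist_norm norm_minus_commute)
    qed
    moreover have "D \<noteq> {}" using D(2) by auto
    ultimately show ?thesis using D(1) halfspace by (auto intro: sets.countable_INT')
  qed
  have "U \<in> sets S" if U: "open U" for U
  proof -
    define I where "I = {(d, r). d \<in> D \<and> r \<in> \<rat> \<and> cball d r \<subseteq> U}"
    have "U = (\<Union>(d, r)\<in>I. cball d r)"
    proof (intro equalityI subsetI)
      fix x assume "x \<in> U"
      then obtain e where e: "0 < e" "ball x e \<subseteq> U" using U openE by blast
      obtain d where d: "d \<in> D" "dist x d < e / 3" using dense[of "e / 3" x] e by auto
      \<comment> \<open>Above \<open>e / 3\<close> the ball around \<open>d\<close> contains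
        \<open>x\<close>; below \<open>2 * e / 3\<close> it stays within distance \<open>e\<close>
        of \<open>x\<close>.\<close>
      obtain r where r: "r \<in> \<rat>" "e / 3 < r" "r < 2 * e / 3"
        using Rats_dense_in_real[of "e / 3" "2 * e / 3"] e by auto
      have "cball d r \<subseteq> ball x e"
      proof
        fix y assume "y \<in> cball d r"
        then show "y \<in> ball x e" using dist_triangle[of x y d] d(2) r by simp
      qed
      then have "(d, r) \<in> I" using d r e by (auto simp: I_def)
      moreover have "x \<in> cball d r" using d r by (simp add: dist_commute)
      ultimately show "x \<in> (\<Union>(d, r)\<in>I. cball d r)" by blast
    qed (auto simp: I_def)
    moreover have "countable I"
      by (rule countable_subset[of _ "D \<times> \<rat>"]) (auto simp: I_def D(1) countable_rat)
    ultimately show ?thesis using cball by (auto intro!: sets.countable_UN')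
  qed
  then have "sigma_sets UNIV {U :: 'w set. open U} \<subseteq> sigma_sets UNIV cylinders"
    unfolding sets_S by (intro sigma_sets_mono) auto
  then show "sets borel \<subseteq> sigma_sets UNIV (cylinders :: 'w set set)"
    by (simp add: borel_def)
qed

lemma Int_stable_cylinders: "Int_stable cylinders"
proof (rule Int_stableI)
  fix C C' :: "'w::real_normed_vector set" assume "C \<in> cylinders" "C' \<in> cylinders"
  then obtain xs ys where "C = cylinder xs" "C' = cylinder ys" "\<forall>(\<phi>, A)\<in>set (xs @ ys). A \<in> sets borel"
    by (force simp: cylinders_def)
  moreover have "cylinder xs \<inter> cylinder ys = cylinder (xs @ ys)" by (auto simp: cylinder_def)
  ultimately show "C \<inter> C' \<in> cylinders" by (auto simp: cylinders_def)
qed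

text \<open>Cylinders form a generator stable under intersection, so it suffices to compare their
  measures. One-dimensional uniqueness is applied to one constraint at a time. The induction carries
  an arbitrary factor \<open>iexp (blinfun_apply \<psi> w)\<close>, for the next coordinate has to
  be tested against characters before its indicator can be inserted; \<open>\<psi> = 0\<close> at
  the end leaves the measure of the cylinder.\<close>

theorem measure_eqI_char_functional:
  fixes N1 N2 :: "'w::real_normed_vector measure"
  assumes D: "countable (D :: 'w set)" "closure D = UNIV"
    and fin: "finite_measure N1" "finite_measure N2"
    and sets: "sets N1 = sets borel" "sets N2 = sets borel"
    and char: "\<And>\<phi> :: 'w \<Rightarrow>\<^sub>L real. (\<integral>w. iexp (blinfun_apply \<phi> w) \<partial>N1) = (\<integral>w. iexp (blinfun_apply \<phi> w) \<partial>N2)"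
  shows "N1 = N2"
proof -
  interpret N1: finite_measure N1 by fact
  interpret N2: finite_measure N2 by fact
  note [measurable_cong] = sets
  let ?C = "\<lambda>xs w. indicator (cylinder xs) w :: real"
  have integrable: "integrable N (\<lambda>w. of_real (?C xs w) * c w :: complex)"
    if "cylinder xs \<in> sets borel" "c \<in> borel_measurable borel" "\<And>w. norm (c w) \<le> 3" "finite_measure N" "sets N = sets borel"
    for N xs and c :: "'w \<Rightarrow> complex"
  proof (rule finite_measure.integrable_const_bound[of _ _ 3])
    show "AE x in N. norm (of_real (?C xs x) * c x) \<le> 3"
      using that(3) by (auto simp: norm_mult indicator_def)
    show "(\<lambda>w. of_real (?C xs w) * c w) \<in> borel_measurable N"
      using that(1,2,5) by (auto simp: measurable_cong_sets[OF that(5) refl])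
  qed fact
  have key: "(\<integral>w. of_real (?C xs w) * iexp (blinfun_apply \<psi> w) \<partial>N1) = (\<integral>w. of_real (?C xs w) * iexp (blinfun_apply \<psi> w) \<partial>N2)"
    if "\<And>\<phi> A. (\<phi>, A) \<in> set xs \<Longrightarrow> A \<in> sets borel" for xs \<psi>
    using that
  proof (induction xs arbitrary: \<psi>)
    case Nil
    then show ?case using char[of \<psi>] by (simp add: cylinder_def)
  next
    case (Cons a xs)
    obtain \<phi> A where a: "a = (\<phi>, A)" by force
    have A: "A \<in> sets borel" using Cons.prems a by auto
    have [measurable]: "cylinder xs \<in> sets borel" using Cons.prems by (intro cylinder_borel) auto
    have [measurable]: "A \<in> sets borel" by (rule A)
    have IH: "(\<integral>w. of_real (?C xs w) * iexp (blinfun_apply \<theta> w) \<partial>N1) = (\<integral>w. of_real (?C xs w) * iexp (blinfun_apply \<theta> w) \<partial>N2)" for \<theta>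
      using Cons by auto
    \<comment> \<open>The weights \<open>1\<close>, \<open>1 + cos \<psi>\<close> and \<open>1 + sin \<psi>\<close> span \<open>exp (\<i> \<psi>)\<close> and are nonnegative, so that the
      one-dimensional uniqueness theorem applies to \<open>\<phi>\<close> under the weighted measures.\<close>
    have step: "(\<integral>w. (?C xs w * c w) * indicator A (blinfun_apply \<phi> w) \<partial>N1) = (\<integral>w. (?C xs w * c w) * indicator A (blinfun_apply \<phi> w) \<partial>N2)"
      if c: "c \<in> borel_measurable borel" "\<And>w. 0 \<le> c w" "\<And>w. c w \<le> 2"
        and eq: "\<And>w. of_real (c w) = 1 + \<alpha> * iexp (blinfun_apply \<psi> w) + \<beta> * iexp (- blinfun_apply \<psi> w)"
      for c \<alpha> \<beta>
    proof (rule weighted_Levy_uniqueness)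
      have c3: "c w \<le> 3" for w using c(3)[of w] by simp
      have int: "integrable N (\<lambda>w. ?C xs w * c w)" if "finite_measure N" "sets N = sets borel" for N
        using integrable[of xs "\<lambda>w. of_real (c w)" N] that c c3
        unfolding of_real_mult[symmetric] complex_of_real_integrable_eq by simp
      show "integrable N1 (\<lambda>w. ?C xs w * c w)" "integrable N2 (\<lambda>w. ?C xs w * c w)"
        by (rule int; fact)+
      show "0 \<le> ?C xs w * c w" for w using c by simp
      \<comment> \<open>Products of characters are characters of sums: the frequency
        \<open>t\<close> of the new coordinate merges with \<psi>, and every term is again of the
        form covered by the induction hypothesis.\<close>
      have expand: "(\<integral>w. of_real (?C xs w * c w) * iexp (t * blinfun_apply \<phi> w) \<partial>N) =
          (\<integral>w. of_real (?C xs w) * iexp (blinfun_apply (t *\<^sub>R \<phi>) w) \<partial>N)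
          + \<alpha> * (\<integral>w. of_real (?C xs w) * iexp (blinfun_apply (\<psi> + t *\<^sub>R \<phi>) w) \<partial>N)
          + \<beta> * (\<integral>w. of_real (?C xs w) * iexp (blinfun_apply (t *\<^sub>R \<phi> - \<psi>) w) \<partial>N)"
        if N: "finite_measure N" "sets N = sets borel" for N t
      proof -
        have I: "integrable N (\<lambda>w. of_real (?C xs w) * iexp (blinfun_apply \<theta> w))" for \<theta>
          by (intro integrable N) auto
        have "(\<lambda>w. of_real (?C xs w * c w) * iexp (t * blinfun_apply \<phi> w)) =
          (\<lambda>w. of_real (?C xs w) * iexp (blinfun_apply (t *\<^sub>R \<phi>) w)
            + \<alpha> * (of_real (?C xs w) * iexp (blinfun_apply (\<psi> + t *\<^sub>R \<phi>) w))
            + \<beta> * (of_real (?C xs w) * iexp (blinfun_apply (t *\<^sub>R \<phi> - \<psi>) w)))"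
        proof
          fix w
          have "iexp (blinfun_apply (\<psi> + t *\<^sub>R \<phi>) w) = iexp (blinfun_apply \<psi> w) * iexp (t * blinfun_apply \<phi> w)"
            "iexp (blinfun_apply (t *\<^sub>R \<phi> - \<psi>) w) = iexp (- blinfun_apply \<psi> w) * iexp (t * blinfun_apply \<phi> w)"
            "iexp (blinfun_apply (t *\<^sub>R \<phi>) w) = iexp (t * blinfun_apply \<phi> w)"
            by (simp_all add: exp_add[symmetric] blinfun.add_left blinfun.diff_left blinfun.scaleR_left algebra_simps)
          then show "of_real (?C xs w * c w) * iexp (t * blinfun_apply \<phi> w) =
             of_real (?C xs w) * iexp (blinfun_apply (t *\<^sub>R \<phi>) w)
            + \<alpha> * (of_real (?C xs w) * iexp (blinfun_apply (\<psi> + t *\<^sub>R \<phi>) w))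
            + \<beta> * (of_real (?C xs w) * iexp (blinfun_apply (t *\<^sub>R \<phi> - \<psi>) w))"
            by (simp only: of_real_mult eq) (simp add: algebra_simps)
        qed
        then show ?thesis using I by simp
      qed
      show "(\<integral>w. of_real (?C xs w * c w) * iexp (t * blinfun_apply \<phi> w) \<partial>N1) =
          (\<integral>w. of_real (?C xs w * c w) * iexp (t * blinfun_apply \<phi> w) \<partial>N2)" for t
        unfolding expand[OF fin(1) sets(1)] expand[OF fin(2) sets(2)] IH ..
    qed (use fin A in \<open>auto\<close>)
    have cyl: "?C (a # xs) w = ?C xs w * indicator A (blinfun_apply \<phi> w)" for w
      by (auto simp: cylinder_def a indicator_def)
    have bnd: "0 \<le> 1 + cos x" "0 \<le> 1 + sin x" for x :: real
      using cos_ge_minus_one[of x] sin_ge_minus_one[of x] by linarith+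
    have eq1: "(\<integral>w. ?C (a # xs) w \<partial>N1) = (\<integral>w. ?C (a # xs) w \<partial>N2)"
      using step[of "\<lambda>_. 1" 0 0] by (simp add: cyl)
    have eqc: "(\<integral>w. ?C (a # xs) w * (1 + cos (blinfun_apply \<psi> w)) \<partial>N1) = (\<integral>w. ?C (a # xs) w * (1 + cos (blinfun_apply \<psi> w)) \<partial>N2)"
      using step[of "\<lambda>w. 1 + cos (blinfun_apply \<psi> w)" "1/2" "1/2"] bnd
      by (simp add: cyl cos_of_real[symmetric] cos_exp_eq ac_simps add_divide_distrib del: cos_of_real)
    have eqs: "(\<integral>w. ?C (a # xs) w * (1 + sin (blinfun_apply \<psi> w)) \<partial>N1) = (\<integral>w. ?C (a # xs) w * (1 + sin (blinfun_apply \<psi> w)) \<partial>N2)"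
      using step[of "\<lambda>w. 1 + sin (blinfun_apply \<psi> w)" "1/(2*\<i>)" "-1/(2*\<i>)"] bnd
      by (simp add: cyl sin_of_real[symmetric] sin_exp_eq ac_simps diff_divide_distrib del: sin_of_real)
    have "cylinder (a # xs) \<in> sets borel" using Cons.prems by (intro cylinder_borel) auto
    then have [measurable]: "cylinder (a # xs) \<in> sets borel" .
    \<comment> \<open>Subtracts the constants \<open>1\<close> that were added to make the cosine
      and sine weights nonnegative.\<close>
    have split: "(\<integral>w. of_real (?C (a # xs) w) * iexp (blinfun_apply \<psi> w) \<partial>N) =
        of_real (\<integral>w. ?C (a # xs) w * (1 + cos (blinfun_apply \<psi> w)) \<partial>N)
        + \<i> * of_real (\<integral>w. ?C (a # xs) w * (1 + sin (blinfun_apply \<psi> w)) \<partial>N)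
        - (1 + \<i>) * of_real (\<integral>w. ?C (a # xs) w \<partial>N)"
      if N: "finite_measure N" "sets N = sets borel" for N
    proof -
      have I: "integrable N (\<lambda>w. of_real (?C (a # xs) w) * of_real (c w) :: complex)"
        if "c \<in> borel_measurable borel" "\<And>w. \<bar>c w\<bar> \<le> 3" for c
        using that by (intro integrable N) auto
      have I1: "integrable N (\<lambda>w. of_real (?C (a # xs) w) * of_real 1 :: complex)"
        by (rule I) auto
      have Ic: "integrable N (\<lambda>w. of_real (?C (a # xs) w) * of_real (1 + cos (blinfun_apply \<psi> w)) :: complex)"
        by (rule I) (use bnd cos_le_one in \<open>auto simp: abs_le_iff intro: order_trans[OF cos_le_one]\<close>)
      have Is: "integrable N (\<lambda>w. of_real (?C (a # xs) w) * of_real (1 + sin (blinfun_apply \<psi> w)) :: complex)"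
        by (rule I) (use bnd sin_le_one in \<open>auto simp: abs_le_iff intro: order_trans[OF sin_le_one]\<close>)
      have "(\<lambda>w. of_real (?C (a # xs) w) * iexp (blinfun_apply \<psi> w)) =
        (\<lambda>w. of_real (?C (a # xs) w) * of_real (1 + cos (blinfun_apply \<psi> w))
          + \<i> * (of_real (?C (a # xs) w) * of_real (1 + sin (blinfun_apply \<psi> w)))
          - (1 + \<i>) * (of_real (?C (a # xs) w) * of_real 1))"
        by (simp add: exp_Euler cos_of_real sin_of_real algebra_simps)
      then show ?thesis
        using I1 Ic Is unfolding integral_complex_of_real[symmetric] of_real_mult
        by simp
    qed
    show ?case
      unfolding split[OF fin(1) sets(1)] split[OF fin(2) sets(2)] eq1 eqc eqs ..
  qed
  have space: "space N1 = UNIV" "space N2 = UNIV"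
    using sets_eq_imp_space_eq[OF sets(1)] sets_eq_imp_space_eq[OF sets(2)] by auto
  have cyl_eq: "emeasure N1 C = emeasure N2 C" if C_cyl: "C \<in> cylinders" for C
  proof -
    obtain xs where "C = cylinder xs" "\<forall>(\<phi>, A)\<in>set xs. A \<in> sets borel"
      using C_cyl by (auto simp: cylinders_def)
    then have xs: "C = cylinder xs" "\<And>\<phi> A. (\<phi>, A) \<in> set xs \<Longrightarrow> A \<in> sets borel"
      by auto
    have C: "C \<in> sets borel" using xs by (auto intro: cylinder_borel)
    have "(\<integral>w. of_real (?C xs w) * iexp (blinfun_apply 0 w) \<partial>N1) = (\<integral>w. of_real (?C xs w) * iexp (blinfun_apply 0 w) \<partial>N2)"
      by (rule key) (rule xs(2))
    then have "complex_of_real (\<integral>w. ?C xs w \<partial>N1) = complex_of_real (\<integral>w. ?C xs w \<partial>N2)"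
      unfolding integral_complex_of_real[symmetric] by simp
    then have "measure N1 C = measure N2 C" using C xs(1) space sets by (simp add: of_real_eq_iff)
    then show ?thesis by (simp add: N1.emeasure_eq_measure N2.emeasure_eq_measure)
  qed
  have UNIV: "UNIV \<in> (cylinders :: 'w set set)"
    by (auto simp: cylinders_def cylinder_def intro!: image_eqI[of _ _ "[]"])
  show ?thesis
    by (rule measure_eqI_generator_eq[OF Int_stable_cylinders, of UNIV, where A = "\<lambda>_. UNIV"])
       (use cyl_eq sets UNIV in \<open>auto simp: sigma_sets_cylinders[OF D] N1.emeasure_eq_measure\<close>)
qed

section \<open>Exponential moments\<close>

text \<open>Expanding the exponential and integrating term by term exhibits the integral as a power
  series in \<open>z\<close> that converges everywhere.\<close>

lemma holomorphic_exponential_integral: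
  fixes u :: "'a \<Rightarrow> complex" and Y :: "'a \<Rightarrow> real"
  assumes [measurable]: "u \<in> borel_measurable M" "Y \<in> borel_measurable M"
    and int: "\<And>c. integrable M (\<lambda>x. norm (u x) * exp (c * \<bar>Y x\<bar>))"
  shows "(\<lambda>z. \<integral>x. u x * exp (z * of_real (Y x)) \<partial>M) holomorphic_on UNIV"
proof -
  define a where "a n = (\<integral>x. u x * of_real (Y x) ^ n / fact n \<partial>M)" for n
  have sums: "(\<lambda>n. a n * (z - 0) ^ n) sums (\<integral>x. u x * exp (z * of_real (Y x)) \<partial>M)" for z
  proof -
    define f where "f n x = u x * (of_real (Y x) ^ n / fact n) * z ^ n" for n x
    have [measurable]: "f n \<in> borel_measurable M" for n unfolding f_def by measurable
    have f_sums: "(\<lambda>n. f n x) sums (u x * exp (z * of_real (Y x)))" for x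
      using sums_mult[OF exp_converges[of "z * of_real (Y x)"], of "u x"]
      by (simp add: f_def power_mult_distrib scaleR_conv_of_real divide_inverse ac_simps)
    have norm_f: "norm (f n x) = norm (u x) * ((norm z * \<bar>Y x\<bar>) ^ n /\<^sub>R fact n)" for n x
    proof -
      have "cmod (inverse (fact n)) = inverse (fact n)" by (simp add: norm_inverse)
      then show ?thesis
        by (simp add: f_def norm_mult norm_power power_mult_distrib divide_inverse ac_simps)
    qed
    \<comment> \<open>This single bound, independent of \<open>n\<close>, gives integrability of the
      terms, pointwise absolute summability and summability of the integrals.\<close>
    have partial: "(\<Sum>i<n. norm (f i x)) \<le> norm (u x) * exp (norm z * \<bar>Y x\<bar>)" for x n
    proof -
      have "(\<Sum>i<n. (norm z * \<bar>Y x\<bar>) ^ i /\<^sub>R fact i) \<le> exp (norm z * \<bar>Y x\<bar>)"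
        unfolding exp_def by (intro sum_le_suminf summable_exp_generic) auto
      then show ?thesis
        unfolding norm_f sum_distrib_left[symmetric] by (intro mult_left_mono) auto
    qed
    have int_f: "integrable M (f n)" for n
    proof (rule Bochner_Integration.integrable_bound[OF int[of "norm z"]])
      have "norm (f n x) \<le> norm (u x) * exp (norm z * \<bar>Y x\<bar>)" for x
      proof -
        have "norm (f n x) \<le> (\<Sum>i<Suc n. norm (f i x))" by (simp add: sum_nonneg)
        then show ?thesis using partial[of x "Suc n"] by (rule order_trans)
      qed
      then show "AE x in M. norm (f n x) \<le> norm (norm (u x) * exp (norm z * \<bar>Y x\<bar>))"
        by (simp add: abs_mult)
    qed measurable
    have "(\<lambda>n. integral\<^sup>L M (f n)) sums (\<integral>x. (\<Sum>n. f n x) \<partial>M)"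
    proof (rule sums_integral[OF int_f])
      show "AE x in M. summable (\<lambda>i. norm (f i x))"
      proof (intro AE_I2 summableI_nonneg_bounded)
        show "(\<Sum>i<n. norm (f i x)) \<le> norm (u x) * exp (norm z * \<bar>Y x\<bar>)" for n x
          by (rule partial)
      qed simp
      show "summable (\<lambda>i. \<integral>x. norm (f i x) \<partial>M)"
      proof (rule summableI_nonneg_bounded)
        fix n
        have "(\<Sum>i<n. \<integral>x. norm (f i x) \<partial>M) = (\<integral>x. (\<Sum>i<n. norm (f i x)) \<partial>M)"
          using int_f by simp
        also have "\<dots> \<le> (\<integral>x. norm (u x) * exp (norm z * \<bar>Y x\<bar>) \<partial>M)"
          using int_f by (intro integral_mono int partial) auto
        finally show "(\<Sum>i<n. \<integral>x. norm (f i x) \<partial>M) \<le> (\<integral>x. norm (u x) * exp (norm z * \<bar>Y x\<bar>) \<partial>M)" .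
      qed simp
    qed
    moreover have "integral\<^sup>L M (f n) = a n * (z - 0) ^ n" for n
      unfolding a_def f_def by simp
    moreover have "(\<Sum>n. f n x) = u x * exp (z * of_real (Y x))" for x
      using f_sums by (rule sums_unique[symmetric])
    ultimately show ?thesis by simp
  qed
  have "(\<lambda>z. \<integral>x. u x * exp (z * of_real (Y x)) \<partial>M) holomorphic_on ball 0 (norm z + 1)" for z :: complex
    by (rule power_series_holomorphic) (rule sums)
  note hol = this
  show ?thesis
  proof (rule holomorphic_onI)
    fix z :: complex
    have "z \<in> ball 0 (norm z + 1)" by simp
    from holomorphic_on_imp_differentiable_at[OF hol open_ball this]
    show "(\<lambda>z. \<integral>x. u x * exp (z * of_real (Y x)) \<partial>M) field_differentiable at z within UNIV"
      by (rule field_differentiable_at_within)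
  qed
qed

text \<open>Identity theorem, the line through \<open>0\<close> having \<open>0\<close> as a limit
  point. Taking \<open>c = \<i>\<close> leads from characteristic functions to exponential moments,
  and \<open>c = 1\<close> leads back.\<close>

lemma entire_eq_on_line:
  assumes f: "f holomorphic_on UNIV" and g: "g holomorphic_on UNIV"
    and eq: "\<And>t. f (complex_of_real t * c) = g (complex_of_real t * c)" and c: "c \<noteq> 0"
  shows "f z = g z"
proof -
  have "f z - g z = 0"
  proof (rule analytic_continuation[where f = "\<lambda>z. f z - g z" and S = UNIV and \<xi> = 0
        and U = "range (\<lambda>t. complex_of_real t * c)"])
    show "0 islimpt range (\<lambda>t. complex_of_real t * c)"
      unfolding islimpt_approachable
    proof (intro allI impI)
      fix e :: real assume "0 < e"
      then show "\<exists>x'\<in>range (\<lambda>t. complex_of_real t * c). x' \<noteq> 0 \<and> dist x' 0 < e"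
        using c by (intro bexI[of _ "complex_of_real (e / (2 * norm c)) * c"] rangeI) (simp add: norm_mult norm_divide)
    qed
  qed (use f g eq in \<open>auto intro: holomorphic_on_diff\<close>)
  then show ?thesis by simp
qed

section \<open>Centered Gaussian variables\<close>

text \<open>The law is an image of the standard normal one rather than a density, so that
  \<open>\<sigma> = 0\<close>, the point mass at zero, is covered; it occurs for
  \<open>h = 0\<close>.\<close>

definition centered_normal :: "'a measure \<Rightarrow> ('a \<Rightarrow> real) \<Rightarrow> real \<Rightarrow> bool" where
  "centered_normal M Y \<sigma> \<longleftrightarrow>
     Y \<in> borel_measurable M \<and> distr M borel Y = distr std_normal_distribution borel (\<lambda>x. \<sigma> * x)"

lemma centered_normalI:
  assumes "prob_space M" and [measurable]: "Y \<in> borel_measurable M"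
    and char: "\<And>t. (\<integral>x. iexp (t * Y x) \<partial>M) = of_real (exp (- (t\<^sup>2 * \<sigma>\<^sup>2) / 2))"
  shows "centered_normal M Y \<sigma>"
proof -
  interpret M: prob_space M by fact
  interpret N: real_distribution std_normal_distribution by (rule real_dist_normal_dist)
  have "distr M borel Y = distr std_normal_distribution borel (\<lambda>x. \<sigma> * x)"
  proof (rule Levy_uniqueness_finite)
    fix t
    have "(\<integral>x. iexp (t * (\<sigma> * x)) \<partial>std_normal_distribution) = char std_normal_distribution (t * \<sigma>)"
      by (simp add: char_def mult.assoc)
    then show "(\<integral>x. iexp (t * Y x) \<partial>M) = (\<integral>x. iexp (t * (\<sigma> * x)) \<partial>std_normal_distribution)"
      by (simp add: char char_std_normal_distribution power_mult_distrib del: of_real_mult)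
  qed (use M.finite_measure_axioms N.finite_measure_axioms in auto)
  then show ?thesis by (simp add: centered_normal_def)
qed

lemma
  shows integrable_exp_std_normal: "integrable std_normal_distribution (\<lambda>x. exp (s * x))"
    and integral_exp_std_normal: "(\<integral>x. exp (s * x) \<partial>std_normal_distribution) = exp (s\<^sup>2 / 2)"
proof -
  \<comment> \<open>Completing the square: exponential tilting of the standard normal density is a
    shift of its mean by \<open>s\<close>.\<close>
  have *: "std_normal_density x * exp (s * x) = exp (s\<^sup>2 / 2) * normal_density s 1 x" for x
    by (simp add: normal_density_def exp_add[symmetric] power2_eq_square field_simps)
  show "integrable std_normal_distribution (\<lambda>x. exp (s * x))"
    by (subst integrable_density) (auto simp: * normal_density_nonneg)
  show "(\<integral>x. exp (s * x) \<partial>std_normal_distribution) = exp (s\<^sup>2 / 2)"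
    by (subst integral_density) (auto simp: * normal_density_nonneg)
qed

lemma
  assumes Y: "centered_normal M Y \<sigma>"
  shows centered_normal_measurable: "Y \<in> borel_measurable M"
    and centered_normal_integrable_exp: "integrable M (\<lambda>x. exp (s * Y x))"
    and centered_normal_integral_exp: "(\<integral>x. exp (s * Y x) \<partial>M) = exp (s\<^sup>2 * \<sigma>\<^sup>2 / 2)"
    and centered_normal_integrable_square: "integrable M (\<lambda>x. (Y x)\<^sup>2)"
    and centered_normal_integral_square: "(\<integral>x. (Y x)\<^sup>2 \<partial>M) = \<sigma>\<^sup>2"
    and centered_normal_char: "(\<integral>x. iexp (t * Y x) \<partial>M) = of_real (exp (- (t\<^sup>2 * \<sigma>\<^sup>2) / 2))"
proof -
  show [measurable]: "Y \<in> borel_measurable M" using Y by (simp add: centered_normal_def)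
  have law: "distr M borel Y = distr std_normal_distribution borel (\<lambda>x. \<sigma> * x)"
    using Y by (simp add: centered_normal_def)
  have int: "integrable M (\<lambda>x. h (Y x)) \<longleftrightarrow> integrable std_normal_distribution (\<lambda>x. h (\<sigma> * x))"
    and eq: "(\<integral>x. h (Y x) \<partial>M) = (\<integral>x. h (\<sigma> * x) \<partial>std_normal_distribution)"
    if [measurable]: "h \<in> borel_measurable borel" for h :: "real \<Rightarrow> 'b::{banach, second_countable_topology}"
  proof -
    have "integrable M (\<lambda>x. h (Y x)) \<longleftrightarrow> integrable (distr M borel Y) h"
      by (subst integrable_distr_eq) auto
    also have "\<dots> \<longleftrightarrow> integrable std_normal_distribution (\<lambda>x. h (\<sigma> * x))"
      unfolding law by (subst integrable_distr_eq) auto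
    finally show "integrable M (\<lambda>x. h (Y x)) \<longleftrightarrow> integrable std_normal_distribution (\<lambda>x. h (\<sigma> * x))" .
    have "(\<integral>x. h (Y x) \<partial>M) = (\<integral>x. h x \<partial>(distr M borel Y))"
      by (subst integral_distr) auto
    also have "\<dots> = (\<integral>x. h (\<sigma> * x) \<partial>std_normal_distribution)"
      unfolding law by (subst integral_distr) auto
    finally show "(\<integral>x. h (Y x) \<partial>M) = (\<integral>x. h (\<sigma> * x) \<partial>std_normal_distribution)" .
  qed
  show "integrable M (\<lambda>x. exp (s * Y x))"
    using integrable_exp_std_normal[of "s * \<sigma>"] by (subst int) (auto simp: mult.assoc)
  show "(\<integral>x. exp (s * Y x) \<partial>M) = exp (s\<^sup>2 * \<sigma>\<^sup>2 / 2)"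
    using integral_exp_std_normal[of "s * \<sigma>"] by (subst eq) (auto simp: mult.assoc power_mult_distrib)
  show "integrable M (\<lambda>x. (Y x)\<^sup>2)"
    using integrable_std_normal_distribution_moment[of 2] by (subst int) (auto simp: power_mult_distrib)
  show "(\<integral>x. (Y x)\<^sup>2 \<partial>M) = \<sigma>\<^sup>2"
    using std_normal_distribution_even_moments(1)[of 1] by (subst eq) (auto simp: power_mult_distrib fact_numeral)
  have "(\<integral>x. iexp (t * (\<sigma> * x)) \<partial>std_normal_distribution) = char std_normal_distribution (t * \<sigma>)"
    by (simp add: char_def mult.assoc)
  then show "(\<integral>x. iexp (t * Y x) \<partial>M) = of_real (exp (- (t\<^sup>2 * \<sigma>\<^sup>2) / 2))"
    by (subst eq) (auto simp: char_std_normal_distribution power_mult_distrib)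
qed

text \<open>Supplies the domination under which exponential integrals of a Gaussian variable are
  entire.\<close>

lemma centered_normal_integrable_exp_abs:
  assumes Y: "centered_normal M Y \<sigma>"
  shows "integrable M (\<lambda>x. exp (c * \<bar>Y x\<bar>))"
proof (rule Bochner_Integration.integrable_bound)
  note [measurable] = centered_normal_measurable[OF Y]
  show "integrable M (\<lambda>x. exp (c * Y x) + exp (- c * Y x))"
    by (intro Bochner_Integration.integrable_add centered_normal_integrable_exp[OF Y])
  show "AE x in M. norm (exp (c * \<bar>Y x\<bar>)) \<le> norm (exp (c * Y x) + exp (- c * Y x))"
  proof (rule AE_I2)
    fix x
    have "exp (c * \<bar>Y x\<bar>) \<le> exp (c * Y x) + exp (- c * Y x)" by (auto simp: abs_if)
    then show "norm (exp (c * \<bar>Y x\<bar>)) \<le> norm (exp (c * Y x) + exp (- c * Y x))" by simp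
  qed
  show "(\<lambda>x. exp (c * \<bar>Y x\<bar>)) \<in> borel_measurable M" by measurable
qed

section \<open>Wiener integrals\<close>

text \<open>Passes from smallness in mean square to smallness in mean, the form in which
  almost-everywhere Cauchy subsequences are extracted. The pointwise bound is the
  arithmetic-geometric mean inequality, scaled so that each half contributes less than or exactly
  \<open>e / 2\<close>.\<close>

lemma (in prob_space) expectation_abs_less:
  fixes Y :: "'a \<Rightarrow> real"
  assumes [measurable]: "Y \<in> borel_measurable M"
    and int: "integrable M (\<lambda>x. (Y x)\<^sup>2)" and e: "0 < e" "expectation (\<lambda>x. (Y x)\<^sup>2) < e\<^sup>2"
  shows "expectation (\<lambda>x. \<bar>Y x\<bar>) < e"
proof -
  have Y: "integrable M Y" using int by (rule square_integrable_imp_integrable[rotated]) measurable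
  have "expectation (\<lambda>x. \<bar>Y x\<bar>) \<le> expectation (\<lambda>x. (Y x)\<^sup>2 / (2 * e) + e / 2)"
  proof (rule integral_mono)
    show "\<bar>Y x\<bar> \<le> (Y x)\<^sup>2 / (2 * e) + e / 2" for x
    proof -
      have "0 \<le> (\<bar>Y x\<bar> - e)\<^sup>2" by simp
      then show ?thesis using e by (simp add: power2_diff power2_eq_square field_simps)
    qed
  qed (use Y int in auto)
  also have "\<dots> = expectation (\<lambda>x. (Y x)\<^sup>2) / (2 * e) + e / 2"
    using int by (simp add: prob_space)
  also have "\<dots> < e" using e by (simp add: power2_eq_square field_simps)
  finally show ?thesis .
qed

context abstract_wiener_space
begin

lemma sets_mu [measurable_cong]: "sets \<mu> = sets borel"
  by (rule sets_borel)

section \<open>The inclusion of the dual of \<open>W\<close> in \<open>H\<close>\<close>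

text \<open>Riesz gives existence and uniqueness of the representing vector, which makes the
  \<open>THE\<close> in \<open>dual_emb\<close> meaningful.\<close>

lemma inner_dual_emb: "blinfun_apply \<phi> (\<iota> h) = inner h (dual_emb \<iota> \<phi>)"
proof -
  have "bounded_linear (\<lambda>h. blinfun_apply \<phi> (\<iota> h))"
    by (intro bounded_linear_compose[OF blinfun.bounded_linear_right] embedding_bounded_linear)
  from theI'[OF Riesz_representation[OF this]] show ?thesis
    unfolding dual_emb_def by blast
qed

lemma dual_emb_eqI: "(\<And>h. blinfun_apply \<phi> (\<iota> h) = inner h k) \<Longrightarrow> dual_emb \<iota> \<phi> = k"
  using inner_dual_emb[of \<phi>] by (metis inner_commute vector_eq_ldot)

lemma dual_emb_add: "dual_emb \<iota> (\<phi> + \<psi>) = dual_emb \<iota> \<phi> + dual_emb \<iota> \<psi>"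
  by (rule dual_emb_eqI) (simp add: blinfun.add_left inner_add_right flip: inner_dual_emb)

lemma dual_emb_scaleR: "dual_emb \<iota> (c *\<^sub>R \<phi>) = c *\<^sub>R dual_emb \<iota> \<phi>"
  by (rule dual_emb_eqI) (simp add: blinfun.scaleR_left flip: inner_dual_emb)

lemma dual_emb_diff: "dual_emb \<iota> (\<phi> - \<psi>) = dual_emb \<iota> \<phi> - dual_emb \<iota> \<psi>"
  by (rule dual_emb_eqI) (simp add: blinfun.diff_left inner_diff_right flip: inner_dual_emb)

lemma dual_emb_zero [simp]: "dual_emb \<iota> 0 = 0"
  by (rule dual_emb_eqI) simp

text \<open>Otherwise a nonzero functional on \<open>H\<close>, say the inner product with
  \<open>k\<close>, kills the range. Then every functional on \<open>W\<close> vanishes at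
  \<open>\<iota> k\<close>, so \<open>\<iota> k = 0\<close>, and injectivity of \<iota> gives the
  contradiction \<open>k = 0\<close>.\<close>

lemma closure_range_dual_emb: "closure (range (dual_emb \<iota>)) = UNIV"
proof (rule ccontr)
  assume "closure (range (dual_emb \<iota>)) \<noteq> UNIV"
  then obtain x where x: "x \<notin> closure (range (dual_emb \<iota>))" by auto
  have "subspace (range (dual_emb \<iota>))"
    unfolding subspace_def
  proof (intro conjI ballI allI)
    show "0 \<in> range (dual_emb \<iota>)" by (rule range_eqI[of _ _ 0]) simp
  qed (auto simp flip: dual_emb_add dual_emb_scaleR)
  then obtain L where L: "bounded_linear L" "\<And>s. s \<in> range (dual_emb \<iota>) \<Longrightarrow> L s = 0" "L x \<noteq> (0 :: real)"
    using x by (rule subspace_functional) (rule that)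
  obtain k where k: "\<And>h. L h = inner h k" using ex1_implies_ex[OF Riesz_representation[OF L(1)]] by auto
  have "\<iota> k = \<iota> 0"
  proof (rule blinfun_eq_on_imp_eq)
    show "blinfun_apply \<phi> (\<iota> k) = blinfun_apply \<phi> (\<iota> 0)" for \<phi> :: "'w \<Rightarrow>\<^sub>L real"
      using L(2)[of "dual_emb \<iota> \<phi>"] by (simp add: inner_dual_emb k inner_commute)
  qed
  then have "k = 0" using embedding_inj by (auto dest: injD)
  then show False using L(3) by (simp add: k)
qed

lemma dual_emb_approximation:
  obtains \<phi> :: "nat \<Rightarrow> 'w \<Rightarrow>\<^sub>L real" where "(\<lambda>j. dual_emb \<iota> (\<phi> j)) \<longlonglongrightarrow> h"
proof -
  have "h \<in> closure (range (dual_emb \<iota>))" by (simp add: closure_range_dual_emb)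
  then obtain f where f: "\<And>n. f n \<in> range (dual_emb \<iota>)" "f \<longlonglongrightarrow> h"
    unfolding closure_sequential by auto
  from f(1) have "\<forall>n. \<exists>\<phi>. f n = dual_emb \<iota> \<phi>" by (auto simp: image_iff)
  then obtain \<phi> where "\<forall>n. f n = dual_emb \<iota> (\<phi> n)" by (rule choice[THEN exE])
  then have "f = (\<lambda>n. dual_emb \<iota> (\<phi> n))" by (simp add: fun_eq_iff)
  with f(2) show thesis by (intro that[of \<phi>]) simp
qed

lemma separable:
  obtains Q :: "'w set" where "countable Q" "closure Q = UNIV"
proof -
  obtain Q0 :: "'h set" where Q0: "countable Q0" "\<And>U. open U \<Longrightarrow> U \<noteq> {} \<Longrightarrow> \<exists>d\<in>Q0. d \<in> U"
    using countable_dense_exists by blast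
  have "closure Q0 = UNIV"
  proof (rule ccontr)
    assume "closure Q0 \<noteq> UNIV"
    then obtain d where "d \<in> Q0" "d \<in> - closure Q0" using Q0(2)[of "- closure Q0"] by auto
    then show False using closure_subset[of Q0] by auto
  qed
  moreover have "continuous_on UNIV \<iota>"
    using embedding_bounded_linear by (simp add: linear_continuous_on)
  ultimately have "range \<iota> \<subseteq> closure (\<iota> ` Q0)"
    using image_closure_subset[of Q0 \<iota> "closure (\<iota> ` Q0)"] closure_subset[of "\<iota> ` Q0"] by simp
  then have "closure (\<iota> ` Q0) = UNIV"
    using closure_minimal[of "range \<iota>" "closure (\<iota> ` Q0)"] embedding_dense by auto
  then show thesis using Q0(1) by (intro that[of "\<iota> ` Q0"]) simp_all
qed

lemma measure_eqI_char:
  assumes "finite_measure N1" "finite_measure N2" "sets N1 = sets borel" "sets N2 = sets borel"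
    and "\<And>\<phi> :: 'w \<Rightarrow>\<^sub>L real. (\<integral>w. iexp (blinfun_apply \<phi> w) \<partial>N1) = (\<integral>w. iexp (blinfun_apply \<phi> w) \<partial>N2)"
  shows "N1 = N2"
  by (rule separable) (rule measure_eqI_char_functional[OF _ _ assms])

lemma centered_normal_dual: "centered_normal \<mu> (blinfun_apply \<phi>) (norm (dual_emb \<iota> \<phi>))"
proof (rule centered_normalI)
  fix t :: real
  show "(\<integral>w. iexp (t * blinfun_apply \<phi> w) \<partial>\<mu>) = of_real (exp (- (t\<^sup>2 * (norm (dual_emb \<iota> \<phi>))\<^sup>2) / 2))"
    using char_function[of "t *\<^sub>R \<phi>"]
    by (simp add: blinfun.scaleR_left dual_emb_scaleR power_mult_distrib)
qed (rule prob_space_axioms, measurable)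

lemma measurable_dual [measurable]: "blinfun_apply (\<phi> :: 'w \<Rightarrow>\<^sub>L real) \<in> borel_measurable \<mu>"
  by (rule centered_normal_measurable[OF centered_normal_dual])

text \<open>The isometry from the dual, with the norm of \<open>H\<close>, into the
  square-integrable functions; the Wiener integral is its extension.\<close>

lemma
  shows integrable_dual_square: "integrable \<mu> (\<lambda>w. (blinfun_apply \<phi> w - blinfun_apply \<psi> w)\<^sup>2)"
    and integral_dual_square: "(\<integral>w. (blinfun_apply \<phi> w - blinfun_apply \<psi> w)\<^sup>2 \<partial>\<mu>) = (norm (dual_emb \<iota> \<phi> - dual_emb \<iota> \<psi>))\<^sup>2"
  using centered_normal_integrable_square[OF centered_normal_dual, of "\<phi> - \<psi>"]
    centered_normal_integral_square[OF centered_normal_dual, of "\<phi> - \<psi>"]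
  by (simp_all add: blinfun.diff_left dual_emb_diff)

section \<open>Construction and linearity of the Wiener integral\<close>

text \<open>\<open>D\<close> is an almost-everywhere limit along a subsequence of one approximating
  sequence. Fatou's lemma bounds its mean-square distance from any functional \<psi> by the distance
  of \<open>dual_emb \<iota> \<psi>\<close> from \<open>h\<close>. With \<open>\<psi> = 0\<close>
  this shows that \<open>D\<close> is square integrable, and with general \<psi> that every
  approximating sequence converges to the same \<open>D\<close>.\<close>

lemma ex_wiener_integral: "\<exists>D. is_wiener_integral \<iota> \<mu> h D"
proof -
  obtain \<phi> where \<phi>: "(\<lambda>j. dual_emb \<iota> (\<phi> j)) \<longlonglongrightarrow> h" by (rule dual_emb_approximation)
  have int: "integrable \<mu> (blinfun_apply (\<phi> n))" for n
    by (rule square_integrable_imp_integrable[OF measurable_dual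
          centered_normal_integrable_square[OF centered_normal_dual]])
  have Cauchy: "\<exists>N. \<forall>i\<ge>N. \<forall>j\<ge>N. (\<integral>w. norm (blinfun_apply (\<phi> i) w - blinfun_apply (\<phi> j) w) \<partial>\<mu>) < e" if e: "0 < e" for e
  proof -
    obtain N where N: "\<And>i j. i \<ge> N \<Longrightarrow> j \<ge> N \<Longrightarrow> norm (dual_emb \<iota> (\<phi> i) - dual_emb \<iota> (\<phi> j)) < e"
      using metric_CauchyD[OF LIMSEQ_imp_Cauchy[OF \<phi>] e] unfolding dist_norm by blast
    have "(\<integral>w. \<bar>blinfun_apply (\<phi> i) w - blinfun_apply (\<phi> j) w\<bar> \<partial>\<mu>) < e" if "i \<ge> N" "j \<ge> N" for i j
    proof (rule expectation_abs_less[OF _ integrable_dual_square e])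
      show "(\<integral>w. (blinfun_apply (\<phi> i) w - blinfun_apply (\<phi> j) w)\<^sup>2 \<partial>\<mu>) < e\<^sup>2"
        unfolding integral_dual_square using N[OF that] by (intro power_strict_mono) auto
    qed measurable
    then show ?thesis by auto
  qed
  obtain r where r: "strict_mono r" "AE w in \<mu>. Cauchy (\<lambda>i. blinfun_apply (\<phi> (r i)) w)"
    using cauchy_L1_AE_cauchy_subseq[OF int Cauchy] by blast
  \<comment> \<open>Where the subsequence diverges, \<open>lim\<close> is an unspecified value;
    these points form a null set.\<close>
  define D where "D w = lim (\<lambda>i. blinfun_apply (\<phi> (r i)) w)" for w
  have [measurable]: "D \<in> borel_measurable \<mu>"
    unfolding D_def by (intro borel_measurable_lim_metric) measurable
  have conv: "AE w in \<mu>. (\<lambda>i. blinfun_apply (\<phi> (r i)) w) \<longlonglongrightarrow> D w"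
    using r(2) by eventually_elim (unfold D_def Cauchy_convergent_iff convergent_LIMSEQ_iff)
  have Fatou: "(\<integral>\<^sup>+w. ennreal ((blinfun_apply \<psi> w - D w)\<^sup>2) \<partial>\<mu>) \<le> ennreal ((norm (dual_emb \<iota> \<psi> - h))\<^sup>2)" for \<psi>
  proof -
    let ?u = "\<lambda>i w. ennreal ((blinfun_apply \<psi> w - blinfun_apply (\<phi> (r i)) w)\<^sup>2)"
    have "(\<integral>\<^sup>+w. ennreal ((blinfun_apply \<psi> w - D w)\<^sup>2) \<partial>\<mu>) = (\<integral>\<^sup>+w. liminf (\<lambda>i. ?u i w) \<partial>\<mu>)"
    proof (rule nn_integral_cong_AE, use conv in eventually_elim)
      fix w assume "(\<lambda>i. blinfun_apply (\<phi> (r i)) w) \<longlonglongrightarrow> D w"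
      then have "(\<lambda>i. ?u i w) \<longlonglongrightarrow> ennreal ((blinfun_apply \<psi> w - D w)\<^sup>2)"
        by (intro tendsto_ennrealI tendsto_power tendsto_diff tendsto_const)
      then show "ennreal ((blinfun_apply \<psi> w - D w)\<^sup>2) = liminf (\<lambda>i. ?u i w)"
        by (intro lim_imp_Liminf[symmetric]) auto
    qed
    also have "\<dots> \<le> liminf (\<lambda>i. \<integral>\<^sup>+w. ?u i w \<partial>\<mu>)"
      by (intro nn_integral_liminf) measurable
    also have "(\<lambda>i. \<integral>\<^sup>+w. ?u i w \<partial>\<mu>) = (\<lambda>i. ennreal ((norm (dual_emb \<iota> \<psi> - dual_emb \<iota> (\<phi> (r i))))\<^sup>2))"
      by (simp add: nn_integral_eq_integral[OF integrable_dual_square] integral_dual_square)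
    also have "liminf \<dots> = ennreal ((norm (dual_emb \<iota> \<psi> - h))\<^sup>2)"
    proof (rule lim_imp_Liminf)
      have "(\<lambda>i. dual_emb \<iota> (\<phi> (r i))) \<longlonglongrightarrow> h"
        using LIMSEQ_subseq_LIMSEQ[OF \<phi> r(1)] by (simp add: o_def)
      then show "(\<lambda>i. ennreal ((norm (dual_emb \<iota> \<psi> - dual_emb \<iota> (\<phi> (r i))))\<^sup>2)) \<longlonglongrightarrow> ennreal ((norm (dual_emb \<iota> \<psi> - h))\<^sup>2)"
        by (intro tendsto_ennrealI tendsto_power tendsto_norm tendsto_diff tendsto_const)
    qed simp
    finally show ?thesis .
  qed
  have int2: "integrable \<mu> (\<lambda>w. (blinfun_apply \<psi> w - D w)\<^sup>2)" for \<psi>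
  proof (rule integrableI_bounded)
    show "(\<integral>\<^sup>+w. ennreal (norm ((blinfun_apply \<psi> w - D w)\<^sup>2)) \<partial>\<mu>) < \<infinity>"
      using le_less_trans[OF Fatou[of \<psi>] ennreal_less_top] by simp
  qed measurable
  have le: "(\<integral>w. (blinfun_apply \<psi> w - D w)\<^sup>2 \<partial>\<mu>) \<le> (norm (dual_emb \<iota> \<psi> - h))\<^sup>2" for \<psi>
    using Fatou[of \<psi>] by (simp add: nn_integral_eq_integral[OF int2])
  have "in_Lp \<mu> 2 D"
    using int2[of 0] by (simp add: in_Lp_def)
  moreover have "(\<lambda>j. \<integral>w. (blinfun_apply (\<psi> j) w - D w)\<^sup>2 \<partial>\<mu>) \<longlonglongrightarrow> 0"
    if "(\<lambda>j. dual_emb \<iota> (\<psi> j)) \<longlonglongrightarrow> h" for \<psi>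
  proof (rule tendsto_sandwich[OF _ _ tendsto_const])
    have "(\<lambda>j. (norm (dual_emb \<iota> (\<psi> j) - h))\<^sup>2) \<longlonglongrightarrow> (norm (h - h))\<^sup>2"
      by (intro tendsto_intros that)
    then show "(\<lambda>j. (norm (dual_emb \<iota> (\<psi> j) - h))\<^sup>2) \<longlonglongrightarrow> 0" by simp
  qed (auto simp: le)
  ultimately show ?thesis unfolding is_wiener_integral_def by blast
qed

abbreviation wiener ("\<delta>") where "\<delta> \<equiv> wiener_integral \<iota> \<mu>"

lemma is_wiener_integral_wiener: "is_wiener_integral \<iota> \<mu> h (\<delta> h)"
  unfolding wiener_integral_def by (rule someI_ex[OF ex_wiener_integral])

lemma wiener_measurable [measurable]: "\<delta> h \<in> borel_measurable \<mu>"
  using is_wiener_integral_wiener[of h] unfolding is_wiener_integral_def in_Lp_def by blast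

text \<open>Pointwise facts about functionals pass to \<open>\<delta> h\<close> through this:
  mean-square convergence gives almost-everywhere convergence along a subsequence.\<close>

lemma wiener_AE_subseq:
  assumes \<phi>: "(\<lambda>j. dual_emb \<iota> (\<phi> j)) \<longlonglongrightarrow> h"
  obtains r :: "nat \<Rightarrow> nat" where "strict_mono r" "AE w in \<mu>. (\<lambda>j. blinfun_apply (\<phi> (r j)) w) \<longlonglongrightarrow> \<delta> h w"
proof -
  have "integrable \<mu> (\<lambda>w. \<bar>\<delta> h w\<bar> powr 2)"
    using is_wiener_integral_wiener[of h] unfolding is_wiener_integral_def in_Lp_def by blast
  then have W: "integrable \<mu> (\<lambda>w. (\<delta> h w)\<^sup>2)" by simp
  have int: "integrable \<mu> (\<lambda>w. (blinfun_apply (\<phi> j) w - \<delta> h w)\<^sup>2)" for j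
  proof (rule Bochner_Integration.integrable_bound)
    show "integrable \<mu> (\<lambda>w. 2 * (blinfun_apply (\<phi> j) w)\<^sup>2 + 2 * (\<delta> h w)\<^sup>2)"
      using W centered_normal_integrable_square[OF centered_normal_dual, of "\<phi> j"] by auto
    have "(a - b)\<^sup>2 \<le> 2 * a\<^sup>2 + 2 * b\<^sup>2" for a b :: real
      using zero_le_power2[of "a + b"] by (simp add: power2_sum power2_diff)
    then show "AE w in \<mu>. norm ((blinfun_apply (\<phi> j) w - \<delta> h w)\<^sup>2) \<le> norm (2 * (blinfun_apply (\<phi> j) w)\<^sup>2 + 2 * (\<delta> h w)\<^sup>2)"
      by auto
  qed measurable
  have "(\<lambda>j. \<integral>w. norm ((blinfun_apply (\<phi> j) w - \<delta> h w)\<^sup>2) \<partial>\<mu>) \<longlonglongrightarrow> 0"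
    using is_wiener_integral_wiener[of h] \<phi> unfolding is_wiener_integral_def by simp
  from tendsto_L1_AE_subseq[OF int this] obtain r where r: "strict_mono r"
    "AE w in \<mu>. (\<lambda>j. (blinfun_apply (\<phi> (r j)) w - \<delta> h w)\<^sup>2) \<longlonglongrightarrow> 0" by blast
  have "AE w in \<mu>. (\<lambda>j. blinfun_apply (\<phi> (r j)) w) \<longlonglongrightarrow> \<delta> h w"
    using r(2)
  proof eventually_elim
    fix w assume "(\<lambda>j. (blinfun_apply (\<phi> (r j)) w - \<delta> h w)\<^sup>2) \<longlonglongrightarrow> 0"
    from tendsto_real_sqrt[OF this] have "(\<lambda>j. blinfun_apply (\<phi> (r j)) w - \<delta> h w) \<longlonglongrightarrow> 0"
      by (simp add: tendsto_rabs_zero_iff)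
    then show "(\<lambda>j. blinfun_apply (\<phi> (r j)) w) \<longlonglongrightarrow> \<delta> h w"
      by (rule LIM_zero_cancel)
  qed
  then show thesis using r(1) that by blast
qed

lemma wiener_dual_emb: "AE w in \<mu>. \<delta> (dual_emb \<iota> \<phi>) w = blinfun_apply \<phi> w"
proof -
  have "AE w in \<mu>. (\<lambda>j::nat. blinfun_apply \<phi> w) \<longlonglongrightarrow> \<delta> (dual_emb \<iota> \<phi>) w"
    by (rule wiener_AE_subseq[of "\<lambda>_. \<phi>"]) simp_all
  then show ?thesis by eventually_elim (simp add: LIMSEQ_const_iff)
qed

text \<open>Three nested subsequences make the approximations of \<open>h\<close>, of
  \<open>k\<close> and of the combination converge at the same points, where linearity of the
  functionals passes to the limit.\<close>

lemma wiener_lincomb: "AE w in \<mu>. \<delta> (c *\<^sub>R h + k) w = c * \<delta> h w + \<delta> k w"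
proof -
  obtain \<phi> where \<phi>: "(\<lambda>j. dual_emb \<iota> (\<phi> j)) \<longlonglongrightarrow> h" by (rule dual_emb_approximation)
  obtain \<psi> where \<psi>: "(\<lambda>j. dual_emb \<iota> (\<psi> j)) \<longlonglongrightarrow> k" by (rule dual_emb_approximation)
  obtain r where r: "strict_mono r" "AE w in \<mu>. (\<lambda>j. blinfun_apply (\<phi> (r j)) w) \<longlonglongrightarrow> \<delta> h w"
    using wiener_AE_subseq[OF \<phi>] by blast
  have "(\<lambda>j. dual_emb \<iota> (\<psi> (r j))) \<longlonglongrightarrow> k"
    using LIMSEQ_subseq_LIMSEQ[OF \<psi> r(1)] by (simp add: o_def)
  from wiener_AE_subseq[OF this] obtain s where s: "strict_mono s"
    "AE w in \<mu>. (\<lambda>j. blinfun_apply (\<psi> (r (s j))) w) \<longlonglongrightarrow> \<delta> k w" by blast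
  have "(\<lambda>j. dual_emb \<iota> (c *\<^sub>R \<phi> (r (s j)) + \<psi> (r (s j)))) \<longlonglongrightarrow> c *\<^sub>R h + k"
    unfolding dual_emb_add dual_emb_scaleR
    using LIMSEQ_subseq_LIMSEQ[OF \<psi> strict_mono_o[OF r(1) s(1)]]
      LIMSEQ_subseq_LIMSEQ[OF \<phi> strict_mono_o[OF r(1) s(1)]]
    by (intro tendsto_intros) (auto simp: o_def)
  from wiener_AE_subseq[OF this] obtain q where q: "strict_mono q"
    "AE w in \<mu>. (\<lambda>j. blinfun_apply (c *\<^sub>R \<phi> (r (s (q j))) + \<psi> (r (s (q j)))) w) \<longlonglongrightarrow> \<delta> (c *\<^sub>R h + k) w" by blast
  show ?thesis
    using r(2) s(2) q(2)
  proof eventually_elim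
    fix w
    assume *: "(\<lambda>j. blinfun_apply (\<phi> (r j)) w) \<longlonglongrightarrow> \<delta> h w"
      "(\<lambda>j. blinfun_apply (\<psi> (r (s j))) w) \<longlonglongrightarrow> \<delta> k w"
      "(\<lambda>j. blinfun_apply (c *\<^sub>R \<phi> (r (s (q j))) + \<psi> (r (s (q j)))) w) \<longlonglongrightarrow> \<delta> (c *\<^sub>R h + k) w"
    have "(\<lambda>j. c * blinfun_apply (\<phi> (r (s (q j)))) w + blinfun_apply (\<psi> (r (s (q j)))) w) \<longlonglongrightarrow> c * \<delta> h w + \<delta> k w"
      using LIMSEQ_subseq_LIMSEQ[OF *(1) strict_mono_o[OF s(1) q(1)]] LIMSEQ_subseq_LIMSEQ[OF *(2) q(1)]
      by (intro tendsto_intros) (auto simp: o_def)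
    then show "\<delta> (c *\<^sub>R h + k) w = c * \<delta> h w + \<delta> k w"
      using LIMSEQ_unique[OF *(3)] by (simp add: blinfun.add_left blinfun.scaleR_left)
  qed
qed

lemma wiener_add: "AE w in \<mu>. \<delta> (h + k) w = \<delta> h w + \<delta> k w"
  using wiener_lincomb[of 1 h k] by simp

lemma wiener_scaleR: "AE w in \<mu>. \<delta> (c *\<^sub>R h) w = c * \<delta> h w"
  using wiener_lincomb[of c h 0] wiener_dual_emb[of 0] by eventually_elim simp

lemma centered_normal_wiener: "centered_normal \<mu> (\<delta> h) (norm h)"
proof (rule centered_normalI)
  fix t :: real
  obtain \<phi> where \<phi>: "(\<lambda>j. dual_emb \<iota> (\<phi> j)) \<longlonglongrightarrow> h" by (rule dual_emb_approximation)
  obtain r where r: "strict_mono r" "AE w in \<mu>. (\<lambda>j. blinfun_apply (\<phi> (r j)) w) \<longlonglongrightarrow> \<delta> h w"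
    using wiener_AE_subseq[OF \<phi>] by blast
  have lim: "(\<lambda>j. \<integral>w. iexp (t * blinfun_apply (\<phi> (r j)) w) \<partial>\<mu>) \<longlonglongrightarrow> (\<integral>w. iexp (t * \<delta> h w) \<partial>\<mu>)"
  proof (rule integral_dominated_convergence[where w = "\<lambda>_. 1"])
    show "AE w in \<mu>. (\<lambda>j. iexp (t * blinfun_apply (\<phi> (r j)) w)) \<longlonglongrightarrow> iexp (t * \<delta> h w)"
      using r(2) by eventually_elim (intro tendsto_intros)
  qed auto
  moreover have "(\<lambda>j. \<integral>w. iexp (t * blinfun_apply (\<phi> (r j)) w) \<partial>\<mu>) \<longlonglongrightarrow> of_real (exp (- (t\<^sup>2 * (norm h)\<^sup>2) / 2))"
    unfolding centered_normal_char[OF centered_normal_dual]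
    using LIMSEQ_subseq_LIMSEQ[OF \<phi> r(1)] by (intro tendsto_intros) (auto simp: o_def)
  ultimately show "(\<integral>w. iexp (t * \<delta> h w) \<partial>\<mu>) = of_real (exp (- (t\<^sup>2 * (norm h)\<^sup>2) / 2))"
    by (rule LIMSEQ_unique)
qed (rule prob_space_axioms, measurable)

end

section \<open>The Cameron--Martin theorem\<close>

text \<open>Young's inequality with constants \<open>1\<close>, obtained by asking whether
  \<open>exp y\<close> lies below or above \<open>a powr (p - 1)\<close>. It takes the place of
  Hoelder's inequality throughout.\<close>

lemma mult_exp_le_powr:
  fixes a p y :: real
  assumes p: "1 < p" and a: "0 \<le> a"
  shows "a * exp y \<le> a powr p + exp (p / (p - 1) * y)"
proof (cases "exp y \<le> a powr (p - 1)")
  case True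
  have "a * exp y \<le> a * a powr (p - 1)" by (intro mult_left_mono True a)
  also have "\<dots> = a powr p" using a p by (cases "a = 0") (auto simp: powr_mult_base)
  finally show ?thesis by (simp add: add_increasing2)
next
  case False
  have "a = (a powr (p - 1)) powr (1 / (p - 1))" using a p by (simp add: powr_powr)
  also have "\<dots> \<le> exp y powr (1 / (p - 1))" using False p by (intro powr_mono2) auto
  also have "\<dots> = exp (y / (p - 1))" by (simp add: powr_def)
  finally have "a * exp y \<le> exp (y / (p - 1)) * exp y" by (rule mult_right_mono) simp
  also have "\<dots> = exp (p / (p - 1) * y)" using p by (simp add: exp_add[symmetric] field_simps)
  finally show ?thesis by (simp add: add_increasing)
qed

lemma integrable_dominated:
  fixes u v :: "'a \<Rightarrow> real"
  assumes v: "integrable M v" and u: "u \<in> borel_measurable M" and le: "\<And>x. \<bar>u x\<bar> \<le> v x"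
  shows "integrable M u"
  using v u
proof (rule Bochner_Integration.integrable_bound)
  show "AE x in M. norm (u x) \<le> norm (v x)"
  proof (rule AE_I2)
    show "norm (u x) \<le> norm (v x)" for x using le[of x] by simp
  qed
qed

context abstract_wiener_space
begin

section \<open>Moments and Fourier transform of Wick exponentials\<close>

abbreviation wick ("\<E>") where "\<E> \<equiv> wick_exp \<iota> \<mu>"

lemma wick_measurable [measurable]: "\<E> h \<in> borel_measurable \<mu>"
  unfolding wick_exp_def by measurable

lemma wick_pos: "0 < \<E> h w"
  by (simp add: wick_exp_def)

lemma integrable_exp_wiener: "integrable \<mu> (\<lambda>w. exp (s * \<delta> h w))"
  by (rule centered_normal_integrable_exp[OF centered_normal_wiener])

lemma integral_exp_wiener: "(\<integral>w. exp (s * \<delta> h w) \<partial>\<mu>) = exp (s\<^sup>2 * (norm h)\<^sup>2 / 2)"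
  by (rule centered_normal_integral_exp[OF centered_normal_wiener])

lemma wick_powr: "\<E> h w powr s = exp (- s * (norm h)\<^sup>2 / 2) * exp (s * \<delta> h w)"
  by (simp add: wick_exp_def powr_def exp_add[symmetric] algebra_simps)

lemma integrable_wick_powr: "integrable \<mu> (\<lambda>w. \<E> h w powr s)"
  unfolding wick_powr by (intro integrable_mult_right integrable_exp_wiener)

lemma integrable_wick: "integrable \<mu> (\<E> h)"
  using integrable_wick_powr[of h 1] wick_pos[of h] by (simp add: less_imp_le)

text \<open>The right-hand side is the characteristic functional of \<mu> shifted by
  \<open>\<iota> h\<close>. For an imaginary multiple of \<open>\<delta> h\<close> in the exponent
  the integrand is a character of a single Wiener integral; analytic continuation then reaches the
  real multiple \<open>1\<close>.\<close>

lemma integral_iexp_wick: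
  "(\<integral>w. iexp (blinfun_apply \<phi> w) * of_real (\<E> h w) \<partial>\<mu>)
     = iexp (inner h (dual_emb \<iota> \<phi>)) * of_real (exp (- (norm (dual_emb \<iota> \<phi>))\<^sup>2 / 2))"
proof -
  define k where "k = dual_emb \<iota> \<phi>"
  define F where "F z = (\<integral>w. iexp (blinfun_apply \<phi> w) * exp (z * of_real (\<delta> h w)) \<partial>\<mu>)" for z
  \<comment> \<open>\<open>F\<close> and \<open>G\<close> agree on the imaginary axis by the characteristic function of \<open>\<delta> (t h + k)\<close>.\<close>
  define G where "G z = exp (- of_real ((norm k)\<^sup>2) / 2 + \<i> * z * of_real (inner h k) + z\<^sup>2 * of_real ((norm h)\<^sup>2) / 2)" for z :: complex
  have "F holomorphic_on UNIV"
    unfolding F_def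
  proof (rule holomorphic_exponential_integral)
    show "integrable \<mu> (\<lambda>w. norm (iexp (blinfun_apply \<phi> w)) * exp (c * \<bar>\<delta> h w\<bar>))" for c
      using centered_normal_integrable_exp_abs[OF centered_normal_wiener, of c h] by simp
  qed measurable
  moreover have "G holomorphic_on UNIV" unfolding G_def by (intro holomorphic_intros) auto
  moreover have "F (of_real t * \<i>) = G (of_real t * \<i>)" for t
  proof -
    have "F (of_real t * \<i>) = (\<integral>w. iexp (1 * \<delta> (t *\<^sub>R h + k) w) \<partial>\<mu>)"
      unfolding F_def
    proof (rule integral_cong_AE)
      show "AE w in \<mu>. iexp (blinfun_apply \<phi> w) * exp (of_real t * \<i> * of_real (\<delta> h w)) = iexp (1 * \<delta> (t *\<^sub>R h + k) w)"
        using wiener_lincomb[of t h k] wiener_dual_emb[of \<phi>] unfolding k_def[symmetric]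
      proof eventually_elim
        fix w assume "\<delta> (t *\<^sub>R h + k) w = t * \<delta> h w + \<delta> k w" "\<delta> k w = blinfun_apply \<phi> w"
        then show "iexp (blinfun_apply \<phi> w) * exp (of_real t * \<i> * of_real (\<delta> h w)) = iexp (1 * \<delta> (t *\<^sub>R h + k) w)"
          by (simp add: exp_add[symmetric] algebra_simps)
      qed
    qed measurable
    also have "\<dots> = of_real (exp (- (norm (t *\<^sub>R h + k))\<^sup>2 / 2))"
      using centered_normal_char[OF centered_normal_wiener, of 1 "t *\<^sub>R h + k"] by simp
    also have "(norm (t *\<^sub>R h + k))\<^sup>2 = t\<^sup>2 * (norm h)\<^sup>2 + 2 * t * inner h k + (norm k)\<^sup>2"
      by (simp add: power2_norm_eq_inner inner_simps inner_commute[of k h] power2_eq_square[of t] algebra_simps)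
    also have "of_real (exp (- (t\<^sup>2 * (norm h)\<^sup>2 + 2 * t * inner h k + (norm k)\<^sup>2) / 2)) = G (of_real t * \<i>)"
      unfolding G_def exp_of_real[symmetric]
      by (rule arg_cong[where f = exp]) (simp add: power_mult_distrib field_simps)
    finally show ?thesis .
  qed
  ultimately have "F 1 = G 1" by (rule entire_eq_on_line[where c = \<i>]) simp
  moreover have "(\<integral>w. iexp (blinfun_apply \<phi> w) * of_real (\<E> h w) \<partial>\<mu>) = of_real (exp (- (norm h)\<^sup>2 / 2)) * F 1"
    unfolding F_def integral_mult_right_zero[symmetric]
    by (intro Bochner_Integration.integral_cong)
       (simp_all add: wick_exp_def exp_of_real[symmetric] exp_add[symmetric] exp_diff field_simps del: exp_of_real)
  moreover have "of_real (exp (- (norm h)\<^sup>2 / 2)) * G 1 = iexp (inner h k) * of_real (exp (- (norm k)\<^sup>2 / 2))"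
    by (simp add: G_def exp_of_real[symmetric] exp_add[symmetric] del: exp_of_real)
  ultimately show ?thesis by (simp add: k_def)
qed

section \<open>Translation along \<open>H\<close>\<close>

lemma translate_measurable [measurable]: "(\<lambda>w. w + c) \<in> measurable \<mu> \<mu>" "(\<lambda>w. w - c) \<in> measurable \<mu> \<mu>"
proof -
  have "(\<lambda>w :: 'w. w + c) \<in> measurable borel borel" "(\<lambda>w :: 'w. w - c) \<in> measurable borel borel"
    by (intro borel_measurable_continuous_onI continuous_intros)+
  then show "(\<lambda>w. w + c) \<in> measurable \<mu> \<mu>" "(\<lambda>w. w - c) \<in> measurable \<mu> \<mu>"
    by (simp_all add: measurable_cong_sets[OF sets_borel sets_borel])
qed

text \<open>Both measures have the same characteristic functional; the shift by
  \<open>- \<iota> k\<close> corresponds to \<open>h = - k\<close> in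
  \<open>integral_iexp_wick\<close>.\<close>

theorem Cameron_Martin: "distr \<mu> \<mu> (\<lambda>w. w - \<iota> k) = density \<mu> (\<lambda>w. ennreal (\<E> (- k) w))"
proof (rule measure_eqI_char)
  show "finite_measure (distr \<mu> \<mu> (\<lambda>w. w - \<iota> k))"
    by (intro finite_measure_distr) measurable
  show "finite_measure (density \<mu> (\<lambda>w. ennreal (\<E> (- k) w)))"
    using integrable_wick[of "- k"] wick_pos[of "- k"]
    by (intro finite_measureI) (simp add: emeasure_density nn_integral_eq_integral less_imp_le cong: nn_integral_cong)
  fix \<phi> :: "'w \<Rightarrow>\<^sub>L real"
  have "(\<integral>w. iexp (blinfun_apply \<phi> w) \<partial>distr \<mu> \<mu> (\<lambda>w. w - \<iota> k)) = (\<integral>w. iexp (blinfun_apply \<phi> (w - \<iota> k)) \<partial>\<mu>)"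
    by (rule integral_distr) measurable
  also have "\<dots> = (\<integral>w. iexp (- inner k (dual_emb \<iota> \<phi>)) * iexp (1 * blinfun_apply \<phi> w) \<partial>\<mu>)"
    by (intro Bochner_Integration.integral_cong)
       (simp_all add: blinfun.diff_right inner_dual_emb exp_add[symmetric] algebra_simps)
  also have "\<dots> = iexp (- inner k (dual_emb \<iota> \<phi>)) * of_real (exp (- (norm (dual_emb \<iota> \<phi>))\<^sup>2 / 2))"
    unfolding integral_mult_right_zero centered_normal_char[OF centered_normal_dual] by simp
  also have "\<dots> = (\<integral>w. iexp (blinfun_apply \<phi> w) * of_real (\<E> (- k) w) \<partial>\<mu>)"
    unfolding integral_iexp_wick by simp
  also have "\<dots> = (\<integral>w. iexp (blinfun_apply \<phi> w) \<partial>density \<mu> (\<lambda>w. ennreal (\<E> (- k) w)))"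
    by (subst integral_density) (auto simp: wick_pos less_imp_le scaleR_conv_of_real mult.commute)
  finally show "(\<integral>w. iexp (blinfun_apply \<phi> w) \<partial>distr \<mu> \<mu> (\<lambda>w. w - \<iota> k)) = (\<integral>w. iexp (blinfun_apply \<phi> w) \<partial>density \<mu> (\<lambda>w. ennreal (\<E> (- k) w)))" .
qed (simp_all add: sets_mu)

text \<open>The shifted measure has a density with respect to \<mu>, so null sets stay null under
  the shift. This is what makes almost-everywhere identities translatable.\<close>

lemma AE_translate:
  assumes "AE w in \<mu>. P w"
  shows "AE w in \<mu>. P (w - \<iota> k)"
proof (rule AE_distrD[where f = "\<lambda>w. w - \<iota> k" and P = P and M' = \<mu>])
  show "AE w in distr \<mu> \<mu> (\<lambda>w. w - \<iota> k). P w"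
    unfolding Cameron_Martin using assms by (subst AE_density) auto
qed measurable

lemma nn_integral_translate:
  assumes [measurable]: "F \<in> borel_measurable \<mu>"
  shows "(\<integral>\<^sup>+w. ennreal (\<E> (- k) w) * F (w + \<iota> k) \<partial>\<mu>) = (\<integral>\<^sup>+w. F w \<partial>\<mu>)"
proof -
  have "(\<integral>\<^sup>+w. ennreal (\<E> (- k) w) * F (w + \<iota> k) \<partial>\<mu>) = (\<integral>\<^sup>+w. F (w + \<iota> k) \<partial>density \<mu> (\<lambda>w. ennreal (\<E> (- k) w)))"
    by (rule nn_integral_density[symmetric]) measurable
  also have "\<dots> = (\<integral>\<^sup>+w. F (w - \<iota> k + \<iota> k) \<partial>\<mu>)"
    unfolding Cameron_Martin[symmetric] by (rule nn_integral_distr) measurable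
  finally show ?thesis by simp
qed

lemma
  fixes F :: "'w \<Rightarrow> real"
  assumes [measurable]: "F \<in> borel_measurable \<mu>"
  shows integrable_translate: "integrable \<mu> F \<Longrightarrow> integrable \<mu> (\<lambda>w. \<E> (- k) w * F (w + \<iota> k))"
    and integral_translate: "(\<integral>w. \<E> (- k) w * F (w + \<iota> k) \<partial>\<mu>) = (\<integral>w. F w \<partial>\<mu>)"
proof -
  have pos: "AE w in \<mu>. 0 \<le> \<E> (- k) w" by (simp add: wick_pos less_imp_le)
  show "integrable \<mu> (\<lambda>w. \<E> (- k) w * F (w + \<iota> k))" if F: "integrable \<mu> F"
  proof -
    have "integrable (distr \<mu> \<mu> (\<lambda>w. w - \<iota> k)) (\<lambda>w. F (w + \<iota> k))"
      by (subst integrable_distr_eq) (simp_all add: F)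
    then show ?thesis
      unfolding Cameron_Martin by (subst (asm) integrable_density) (simp_all add: pos)
  qed
  have "(\<integral>w. \<E> (- k) w * F (w + \<iota> k) \<partial>\<mu>) = (\<integral>w. F (w + \<iota> k) \<partial>density \<mu> (\<lambda>w. ennreal (\<E> (- k) w)))"
    by (subst integral_density) (simp_all add: pos)
  also have "\<dots> = (\<integral>w. F (w - \<iota> k + \<iota> k) \<partial>\<mu>)"
    unfolding Cameron_Martin[symmetric] by (rule integral_distr) measurable
  finally show "(\<integral>w. \<E> (- k) w * F (w + \<iota> k) \<partial>\<mu>) = (\<integral>w. F w \<partial>\<mu>)" by simp
qed

text \<open>For a functional the identity is exact. Along a subsequence the approximations converge
  almost everywhere at \<open>w\<close> and, by \<open>AE_translate\<close>, also at
  \<open>w - \<iota> k\<close>.\<close>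

lemma wiener_translate: "AE w in \<mu>. \<delta> h (w - \<iota> k) = \<delta> h w - inner h k"
proof -
  obtain \<phi> where \<phi>: "(\<lambda>j. dual_emb \<iota> (\<phi> j)) \<longlonglongrightarrow> h" by (rule dual_emb_approximation)
  obtain r where r: "strict_mono r" "AE w in \<mu>. (\<lambda>j. blinfun_apply (\<phi> (r j)) w) \<longlonglongrightarrow> \<delta> h w"
    using wiener_AE_subseq[OF \<phi>] by blast
  have "(\<lambda>j. dual_emb \<iota> (\<phi> (r j))) \<longlonglongrightarrow> h"
    using LIMSEQ_subseq_LIMSEQ[OF \<phi> r(1)] by (simp add: o_def)
  then have inner: "(\<lambda>j. inner k (dual_emb \<iota> (\<phi> (r j)))) \<longlonglongrightarrow> inner k h"
    by (intro tendsto_inner tendsto_const)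
  from r(2) AE_translate[OF r(2), of k] show ?thesis
  proof eventually_elim
    fix w
    assume *: "(\<lambda>j. blinfun_apply (\<phi> (r j)) w) \<longlonglongrightarrow> \<delta> h w"
      "(\<lambda>j. blinfun_apply (\<phi> (r j)) (w - \<iota> k)) \<longlonglongrightarrow> \<delta> h (w - \<iota> k)"
    have "(\<lambda>j. blinfun_apply (\<phi> (r j)) (w - \<iota> k)) \<longlonglongrightarrow> \<delta> h w - inner k h"
      unfolding blinfun.diff_right inner_dual_emb by (intro tendsto_diff *(1) inner)
    from LIMSEQ_unique[OF *(2) this] show "\<delta> h (w - \<iota> k) = \<delta> h w - inner h k"
      by (simp add: inner_commute)
  qed
qed

lemma wick_translate: "AE w in \<mu>. \<E> h (w - \<iota> k) = exp (- inner h k) * \<E> h w"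
  using wiener_translate[of h k] by eventually_elim (simp add: wick_exp_def exp_add[symmetric])

lemma integral_wick_wick: "(\<integral>w. \<E> (- k) w * \<E> h w \<partial>\<mu>) = exp (- inner h k)"
proof -
  have "(\<integral>w. \<E> (- k) w * \<E> h w \<partial>\<mu>) = (\<integral>w. exp (- ((norm h)\<^sup>2 + (norm k)\<^sup>2) / 2) * exp (1 * \<delta> (h + - k) w) \<partial>\<mu>)"
  proof (rule integral_cong_AE)
    show "AE w in \<mu>. \<E> (- k) w * \<E> h w = exp (- ((norm h)\<^sup>2 + (norm k)\<^sup>2) / 2) * exp (1 * \<delta> (h + - k) w)"
      using wiener_add[of h "- k"]
    proof eventually_elim
      fix w assume "\<delta> (h + - k) w = \<delta> h w + \<delta> (- k) w"
      then show "\<E> (- k) w * \<E> h w = exp (- ((norm h)\<^sup>2 + (norm k)\<^sup>2) / 2) * exp (1 * \<delta> (h + - k) w)"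
        by (simp add: wick_exp_def exp_add[symmetric] field_simps)
    qed
  qed measurable
  also have "\<dots> = exp (- ((norm h)\<^sup>2 + (norm k)\<^sup>2) / 2) * exp ((norm (h + - k))\<^sup>2 / 2)"
    unfolding integral_mult_right_zero integral_exp_wiener by simp
  also have "(norm (h + - k))\<^sup>2 = (norm h)\<^sup>2 + (norm k)\<^sup>2 - 2 * inner h k"
    by (simp add: power2_norm_eq_inner inner_simps inner_commute[of k h] algebra_simps)
  finally show ?thesis by (simp add: exp_add[symmetric] field_simps)
qed

section \<open>Integrability against exponentials and totality\<close>

text \<open>Young's inequality plus Gaussian exponential moments. The explicit bound depends on
  \<open>h\<close> only through its norm, hence is uniform on the unit sphere; the first kernel
  needs this.\<close>

lemma integrable_Lp_exp_wiener:
  assumes u: "in_Lp \<mu> p u" and p: "1 < p"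
  shows "integrable \<mu> (\<lambda>w. \<bar>u w\<bar> * exp (c * \<bar>\<delta> h w\<bar>))"
    and "(\<integral>w. \<bar>u w\<bar> * exp (c * \<bar>\<delta> h w\<bar>) \<partial>\<mu>)
       \<le> (\<integral>w. \<bar>u w\<bar> powr p \<partial>\<mu>) + 2 * exp ((p / (p - 1) * c)\<^sup>2 * (norm h)\<^sup>2 / 2)"
proof -
  have [measurable]: "u \<in> borel_measurable \<mu>" and int: "integrable \<mu> (\<lambda>w. \<bar>u w\<bar> powr p)"
    using u by (auto simp: in_Lp_def)
  define d where "d = p / (p - 1) * c"
  let ?B = "\<lambda>w. \<bar>u w\<bar> powr p + (exp (d * \<delta> h w) + exp (- d * \<delta> h w))"
  have bound: "\<bar>u w\<bar> * exp (c * \<bar>\<delta> h w\<bar>) \<le> ?B w" for w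
  proof -
    have "\<bar>u w\<bar> * exp (c * \<bar>\<delta> h w\<bar>) \<le> \<bar>u w\<bar> powr p + exp (d * \<bar>\<delta> h w\<bar>)"
      using mult_exp_le_powr[OF p, of "\<bar>u w\<bar>" "c * \<bar>\<delta> h w\<bar>"] by (simp add: d_def mult.assoc)
    also have "exp (d * \<bar>\<delta> h w\<bar>) \<le> exp (d * \<delta> h w) + exp (- d * \<delta> h w)"
      by (auto simp: abs_if)
    finally show ?thesis by simp
  qed
  have B: "integrable \<mu> ?B"
    by (intro Bochner_Integration.integrable_add int integrable_exp_wiener)
  show *: "integrable \<mu> (\<lambda>w. \<bar>u w\<bar> * exp (c * \<bar>\<delta> h w\<bar>))"
  proof (rule integrable_dominated[OF B])
    show "\<bar>\<bar>u w\<bar> * exp (c * \<bar>\<delta> h w\<bar>)\<bar> \<le> ?B w" for w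
      using bound[of w] by (simp add: abs_mult)
  qed measurable
  have "(\<integral>w. \<bar>u w\<bar> * exp (c * \<bar>\<delta> h w\<bar>) \<partial>\<mu>) \<le> (\<integral>w. ?B w \<partial>\<mu>)"
    by (rule integral_mono[OF * B bound])
  also have "\<dots> = (\<integral>w. \<bar>u w\<bar> powr p \<partial>\<mu>) + 2 * exp (d\<^sup>2 * (norm h)\<^sup>2 / 2)"
    using int integrable_exp_wiener[of d h] integrable_exp_wiener[of "- d" h]
      integral_exp_wiener[of d h] integral_exp_wiener[of "- d" h]
    by simp
  finally show "(\<integral>w. \<bar>u w\<bar> * exp (c * \<bar>\<delta> h w\<bar>) \<partial>\<mu>)
       \<le> (\<integral>w. \<bar>u w\<bar> powr p \<partial>\<mu>) + 2 * exp ((p / (p - 1) * c)\<^sup>2 * (norm h)\<^sup>2 / 2)"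
    by (simp add: d_def)
qed

lemma integrable_Lp_mult:
  fixes v :: "'w \<Rightarrow> real"
  assumes u: "in_Lp \<mu> p u" and p: "1 < p" and [measurable]: "v \<in> borel_measurable \<mu>"
    and v: "\<And>w. \<bar>v w\<bar> \<le> exp (c * \<bar>\<delta> h w\<bar>)"
  shows "integrable \<mu> (\<lambda>w. u w * v w)"
proof (rule integrable_dominated[OF integrable_Lp_exp_wiener(1)[OF u p, of c h]])
  have [measurable]: "u \<in> borel_measurable \<mu>" using u by (simp add: in_Lp_def)
  show "(\<lambda>w. u w * v w) \<in> borel_measurable \<mu>" by measurable
  show "\<bar>u w * v w\<bar> \<le> \<bar>u w\<bar> * exp (c * \<bar>\<delta> h w\<bar>)" for w
    using v[of w] by (simp add: abs_mult mult_left_mono)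
qed

lemma integrable_Lp_wick:
  assumes "in_Lp \<mu> p u" "1 < p"
  shows "integrable \<mu> (\<lambda>w. u w * \<E> h w)"
proof (rule integrable_Lp_mult[OF assms, where c = 1])
  show "\<bar>\<E> h w\<bar> \<le> exp (1 * \<bar>\<delta> h w\<bar>)" for w
    using abs_ge_self[of "\<delta> h w"] zero_le_power2[of "norm h"] unfolding wick_exp_def abs_exp_cancel exp_le_cancel_iff by linarith
qed measurable

lemma integrable_Lp_wiener:
  assumes "in_Lp \<mu> p u" "1 < p"
  shows "integrable \<mu> (\<lambda>w. u w * \<delta> h w)"
proof (rule integrable_Lp_mult[OF assms, where c = 1])
  show "\<bar>\<delta> h w\<bar> \<le> exp (1 * \<bar>\<delta> h w\<bar>)" for w
    using exp_ge_add_one_self[of "\<bar>\<delta> h w\<bar>"] unfolding mult_1 by linarith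
qed measurable

lemma integrable_Lp:
  assumes "in_Lp \<mu> p u" "1 < p"
  shows "integrable \<mu> u"
  using integrable_Lp_mult[OF assms, of "\<lambda>_. 1" 0] by simp

text \<open>Scaling \<open>h\<close> shows that \<open>u\<close> has vanishing exponential moments
  along every Wiener integral; continued to imaginary arguments, they form the characteristic
  functional of the signed measure with density \<open>u\<close>.\<close>

lemma wick_total:
  assumes u: "in_Lp \<mu> p u" and p: "1 < p"
    and zero: "\<And>h. (\<integral>w. u w * \<E> h w \<partial>\<mu>) = 0"
  shows "AE w in \<mu>. u w = 0"
proof -
  have [measurable]: "u \<in> borel_measurable \<mu>" using u by (simp add: in_Lp_def)
  have int: "integrable \<mu> u" by (rule integrable_Lp[OF u p])
  have char0: "(\<integral>w. of_real (u w) * iexp (blinfun_apply \<phi> w) \<partial>\<mu>) = 0" for \<phi>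
  proof -
    define h where "h = dual_emb \<iota> \<phi>"
    define F where "F z = (\<integral>w. of_real (u w) * exp (z * of_real (\<delta> h w)) \<partial>\<mu>)" for z :: complex
    have "F holomorphic_on UNIV"
      unfolding F_def
    proof (rule holomorphic_exponential_integral)
      show "integrable \<mu> (\<lambda>w. norm (complex_of_real (u w)) * exp (c * \<bar>\<delta> h w\<bar>))" for c
        using integrable_Lp_exp_wiener(1)[OF u p] by simp
    qed measurable
    moreover have "(\<lambda>_. 0 :: complex) holomorphic_on UNIV" by (rule holomorphic_on_const)
    moreover have "F (of_real t * 1) = 0" for t
    proof -
      \<comment> \<open>The constant factor undoes the normalisation in the Wick exponential of
        \<open>t *\<^sub>R h\<close>.\<close>
      have "F (of_real t * 1) = of_real (\<integral>w. exp (t\<^sup>2 * (norm h)\<^sup>2 / 2) * (u w * \<E> (t *\<^sub>R h) w) \<partial>\<mu>)"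
        unfolding F_def integral_complex_of_real[symmetric]
      proof (rule integral_cong_AE)
        show "AE w in \<mu>. of_real (u w) * exp (of_real t * 1 * of_real (\<delta> h w))
           = complex_of_real (exp (t\<^sup>2 * (norm h)\<^sup>2 / 2) * (u w * \<E> (t *\<^sub>R h) w))"
          using wiener_scaleR[of t h]
        proof eventually_elim
          fix w assume "\<delta> (t *\<^sub>R h) w = t * \<delta> h w"
          then have "exp (t\<^sup>2 * (norm h)\<^sup>2 / 2) * \<E> (t *\<^sub>R h) w = exp (t * \<delta> h w)"
            by (simp add: wick_exp_def exp_add[symmetric] power_mult_distrib)
          then have "exp (t\<^sup>2 * (norm h)\<^sup>2 / 2) * (u w * \<E> (t *\<^sub>R h) w) = u w * exp (t * \<delta> h w)"
            by (metis mult.left_commute)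
          moreover have "complex_of_real (u w * exp (t * \<delta> h w)) = of_real (u w) * exp (of_real t * 1 * of_real (\<delta> h w))"
            by (simp flip: exp_of_real)
          ultimately show "of_real (u w) * exp (of_real t * 1 * of_real (\<delta> h w))
           = complex_of_real (exp (t\<^sup>2 * (norm h)\<^sup>2 / 2) * (u w * \<E> (t *\<^sub>R h) w))"
            by metis
        qed
      qed measurable
      then show ?thesis by (simp add: zero)
    qed
    ultimately have "F \<i> = 0" by (rule entire_eq_on_line[where c = 1]) simp
    moreover have "(\<integral>w. of_real (u w) * iexp (blinfun_apply \<phi> w) \<partial>\<mu>) = F \<i>"
      unfolding F_def
    proof (rule integral_cong_AE)
      show "AE w in \<mu>. of_real (u w) * iexp (blinfun_apply \<phi> w) = of_real (u w) * exp (\<i> * of_real (\<delta> h w))"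
        using wiener_dual_emb[of \<phi>] unfolding h_def by eventually_elim simp
    qed measurable
    ultimately show ?thesis by simp
  qed
  \<comment> \<open>\<open>N 1\<close> and \<open>N (- 1)\<close> are the positive and negative
    parts of the signed measure, since the uniqueness theorem speaks of measures only. Their
    densities agree only where \<open>u\<close> vanishes.\<close>
  define N where "N s = density \<mu> (\<lambda>w. ennreal (max 0 (s * u w)))" for s
  have N_char: "(\<integral>w. iexp (blinfun_apply \<phi> w) \<partial>N s) = (\<integral>w. of_real (max 0 (s * u w)) * iexp (blinfun_apply \<phi> w) \<partial>\<mu>)" for \<phi> :: "'w \<Rightarrow>\<^sub>L real" and s
    unfolding N_def by (subst integral_density) (simp_all add: scaleR_conv_of_real)
  have N_fin: "finite_measure (N s)" for s
  proof (rule finite_measureI)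
    have "integrable \<mu> (\<lambda>w. max 0 (s * u w))"
      using int by (intro integrable_max) auto
    then have "(\<integral>\<^sup>+w. ennreal (max 0 (s * u w)) \<partial>\<mu>) = ennreal (\<integral>w. max 0 (s * u w) \<partial>\<mu>)"
      by (rule nn_integral_eq_integral) simp
    then show "emeasure (N s) (space (N s)) \<noteq> \<infinity>"
      by (simp add: N_def emeasure_density cong: nn_integral_cong)
  qed
  have "N 1 = N (- 1)"
  proof (rule measure_eqI_char)
    fix \<phi> :: "'w \<Rightarrow>\<^sub>L real"
    have I: "integrable \<mu> (\<lambda>w. of_real (max 0 (s * u w)) * iexp (blinfun_apply \<phi> w))" for s
    proof (rule Bochner_Integration.integrable_bound)
      show "integrable \<mu> (\<lambda>w. s * u w)" using int by simp
    qed (auto simp: norm_mult)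
    have "(\<integral>w. of_real (max 0 (1 * u w)) * iexp (blinfun_apply \<phi> w) \<partial>\<mu>) - (\<integral>w. of_real (max 0 (- 1 * u w)) * iexp (blinfun_apply \<phi> w) \<partial>\<mu>)
       = (\<integral>w. of_real (max 0 (1 * u w)) * iexp (blinfun_apply \<phi> w) - of_real (max 0 (- 1 * u w)) * iexp (blinfun_apply \<phi> w) \<partial>\<mu>)"
      by (rule Bochner_Integration.integral_diff[symmetric]; rule I)
    also have "\<dots> = (\<integral>w. of_real (u w) * iexp (blinfun_apply \<phi> w) \<partial>\<mu>)"
      by (intro Bochner_Integration.integral_cong) (auto simp: max_def)
    finally show "(\<integral>w. iexp (blinfun_apply \<phi> w) \<partial>N 1) = (\<integral>w. iexp (blinfun_apply \<phi> w) \<partial>N (- 1))"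
      unfolding N_char by (simp add: char0)
  qed (auto simp: N_fin, auto simp: N_def sets_mu)
  then have "AE w in \<mu>. ennreal (max 0 (1 * u w)) = ennreal (max 0 (- 1 * u w))"
    unfolding N_def by (subst (asm) density_unique_iff) (auto intro: finite_measure.sigma_finite_measure[OF N_fin, unfolded N_def])
  then show ?thesis
    by eventually_elim (auto simp: max_def split: if_splits)
qed

section \<open>Centering a density\<close>

text \<open>Almost-everywhere linearity of \<open>\<delta>\<close> becomes genuine linearity after
  integration. Boundedness is checked on unit vectors and extended by homogeneity.\<close>

lemma ex_first_kernel:
  assumes f: "in_Lp \<mu> p f" and p: "1 < p"
  shows "\<exists>k. is_first_kernel \<iota> \<mu> f k"
proof -
  have int: "integrable \<mu> (\<lambda>w. \<delta> h w * f w)" for h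
    using integrable_Lp_wiener[OF f p, of h] by (simp add: mult.commute)
  have [measurable]: "f \<in> borel_measurable \<mu>" using f by (simp add: in_Lp_def)
  define F where "F h = (\<integral>w. \<delta> h w * f w \<partial>\<mu>)" for h
  \<comment> \<open>The bound of \<open>integrable_Lp_exp_wiener\<close> for \<open>c = 1\<close>
    and a vector of norm \<open>1\<close>.\<close>
  define K where "K = (\<integral>w. \<bar>f w\<bar> powr p \<partial>\<mu>) + 2 * exp ((p / (p - 1))\<^sup>2 / 2)"
  have F_scaleR: "F (c *\<^sub>R h) = c * F h" for c h
  proof -
    have "F (c *\<^sub>R h) = (\<integral>w. c * (\<delta> h w * f w) \<partial>\<mu>)"
      unfolding F_def
    proof (rule integral_cong_AE)
      show "AE w in \<mu>. \<delta> (c *\<^sub>R h) w * f w = c * (\<delta> h w * f w)"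
        using wiener_scaleR[of c h] by eventually_elim simp
    qed measurable
    then show ?thesis by (simp add: F_def)
  qed
  have F_add: "F (h + k) = F h + F k" for h k
  proof -
    have "F (h + k) = (\<integral>w. \<delta> h w * f w + \<delta> k w * f w \<partial>\<mu>)"
      unfolding F_def
    proof (rule integral_cong_AE)
      show "AE w in \<mu>. \<delta> (h + k) w * f w = \<delta> h w * f w + \<delta> k w * f w"
        using wiener_add[of h k] by eventually_elim (simp add: algebra_simps)
    qed measurable
    then show ?thesis using int by (simp add: F_def)
  qed
  have F_bound: "\<bar>F h\<bar> \<le> norm h * K" for h
  proof (cases "h = 0")
    case True
    then show ?thesis using F_scaleR[of 0 0] by simp
  next
    case False
    define e where "e = sgn h"
    have e: "norm e = 1" "h = norm h *\<^sub>R e"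
      using False by (simp_all add: e_def norm_sgn sgn_div_norm)
    have "\<bar>F e\<bar> \<le> (\<integral>w. \<bar>\<delta> e w * f w\<bar> \<partial>\<mu>)"
      unfolding F_def by (rule integral_abs_bound)
    also have "\<dots> \<le> (\<integral>w. \<bar>f w\<bar> * exp (1 * \<bar>\<delta> e w\<bar>) \<partial>\<mu>)"
    proof (rule integral_mono)
      show "\<bar>\<delta> e w * f w\<bar> \<le> \<bar>f w\<bar> * exp (1 * \<bar>\<delta> e w\<bar>)" for w
      proof -
        have "\<bar>\<delta> e w\<bar> \<le> exp (1 * \<bar>\<delta> e w\<bar>)"
          using exp_ge_add_one_self[of "\<bar>\<delta> e w\<bar>"] unfolding mult_1 by linarith
        then show ?thesis unfolding abs_mult mult.commute[of "\<bar>\<delta> e w\<bar>"] by (rule mult_left_mono) simp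
      qed
    qed (use int[of e] integrable_Lp_exp_wiener(1)[OF f p, of 1 e] in auto)
    also have "\<dots> \<le> K"
      using integrable_Lp_exp_wiener(2)[OF f p, of 1 e] by (simp add: K_def e(1))
    finally have "norm h * \<bar>F e\<bar> \<le> norm h * K" by (intro mult_left_mono) auto
    then show ?thesis by (subst e(2)) (simp add: F_scaleR abs_mult)
  qed
  have "bounded_linear F"
    by (rule bounded_linear_intro[where K = K]) (simp_all add: F_add F_scaleR F_bound)
  from ex1_implies_ex[OF Riesz_representation[OF this]] obtain k where "\<forall>h. F h = inner h k" by auto
  then show ?thesis
    using int by (auto simp: is_first_kernel_def F_def inner_commute intro!: exI[of _ k])
qed

text \<open>One factor \<open>\<E> (- k)\<close> is set aside as the density of the change of
  variables. Young's inequality with exponent \<open>p / q > 1\<close> is applied only to the rest,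
  which separates the power of \<open>f\<close> from that of the Wick exponential.\<close>

lemma in_Lp_translate:
  assumes f: "in_Lp \<mu> p f" and q: "1 \<le> q" "q < p"
  shows "in_Lp \<mu> q (\<lambda>w. \<E> (- k) w * f (w + \<iota> k))"
  unfolding in_Lp_def
proof
  have [measurable]: "f \<in> borel_measurable \<mu>" using f by (simp add: in_Lp_def)
  show "(\<lambda>w. \<E> (- k) w * f (w + \<iota> k)) \<in> borel_measurable \<mu>" by measurable
  \<comment> \<open>The conjugate exponent of \<open>p / q\<close> times the \<open>q - 1\<close>
    surplus factors of the Wick exponential; the reserved factor makes it
    \<open>1 + s\<close>.\<close>
  define s where "s = p / q / (p / q - 1) * (q - 1)"
  have bound: "\<bar>\<E> (- k) w * f (w + \<iota> k)\<bar> powr q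
      \<le> \<E> (- k) w * \<bar>f (w + \<iota> k)\<bar> powr p + \<E> (- k) w powr (1 + s)" for w
  proof -
    define a where "a = \<bar>f (w + \<iota> k)\<bar>"
    define y where "y = ln (\<E> (- k) w)"
    have E: "\<E> (- k) w = exp y" by (simp add: y_def wick_pos)
    have "\<bar>\<E> (- k) w * f (w + \<iota> k)\<bar> powr q = exp y powr q * a powr q"
      unfolding abs_mult by (simp add: powr_mult E a_def)
    also have "\<dots> = exp y * (a powr q * exp ((q - 1) * y))"
      by (simp add: powr_def exp_add[symmetric] algebra_simps)
    also have "\<dots> \<le> exp y * ((a powr q) powr (p / q) + exp (p / q / (p / q - 1) * ((q - 1) * y)))"
      using q by (intro mult_left_mono mult_exp_le_powr) auto
    also have "\<dots> = exp y * a powr p + exp y powr (1 + s)"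
      using q by (simp add: powr_powr powr_def s_def algebra_simps exp_add)
    finally show ?thesis by (simp add: E a_def)
  qed
  have "integrable \<mu> (\<lambda>w. \<E> (- k) w * \<bar>f (w + \<iota> k)\<bar> powr p + \<E> (- k) w powr (1 + s))"
  proof (intro Bochner_Integration.integrable_add integrable_wick_powr)
    show "integrable \<mu> (\<lambda>w. \<E> (- k) w * \<bar>f (w + \<iota> k)\<bar> powr p)"
      by (rule integrable_translate[of "\<lambda>w. \<bar>f w\<bar> powr p"]) (use f in \<open>simp_all add: in_Lp_def\<close>)
  qed
  then show "integrable \<mu> (\<lambda>w. \<bar>\<E> (- k) w * f (w + \<iota> k)\<bar> powr q)"
  proof (rule integrable_dominated)
    show "\<bar>\<bar>\<E> (- k) w * f (w + \<iota> k)\<bar> powr q\<bar>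
      \<le> \<E> (- k) w * \<bar>f (w + \<iota> k)\<bar> powr p + \<E> (- k) w powr (1 + s)" for w
      using bound[of w] unfolding abs_of_nonneg[OF powr_ge_zero] .
  qed measurable
qed

lemma in_Lp_mono:
  assumes u: "in_Lp \<mu> p u" and q: "0 < q" "q \<le> p"
  shows "in_Lp \<mu> q u"
  unfolding in_Lp_def
proof
  show [measurable]: "u \<in> borel_measurable \<mu>" using u by (simp add: in_Lp_def)
  have "integrable \<mu> (\<lambda>w. 1 + \<bar>u w\<bar> powr p)" using u by (simp add: in_Lp_def)
  then show "integrable \<mu> (\<lambda>w. \<bar>u w\<bar> powr q)"
  proof (rule integrable_dominated)
    show "\<bar>\<bar>u w\<bar> powr q\<bar> \<le> 1 + \<bar>u w\<bar> powr p" for w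
    proof (cases "\<bar>u w\<bar> \<le> 1")
      case True
      then have "\<bar>u w\<bar> powr q \<le> 1" using q by (intro powr_le1) auto
      then show ?thesis by (simp add: add_increasing2)
    next
      case False
      then have "\<bar>u w\<bar> powr q \<le> \<bar>u w\<bar> powr p" using q by (intro powr_mono) auto
      then show ?thesis by simp
    qed
  qed measurable
qed

lemma in_Lp_diff:
  assumes u: "in_Lp \<mu> p u" and v: "in_Lp \<mu> p v" and p: "0 < p"
  shows "in_Lp \<mu> p (\<lambda>w. u w - v w)"
  unfolding in_Lp_def
proof
  have [measurable]: "u \<in> borel_measurable \<mu>" "v \<in> borel_measurable \<mu>" using u v by (auto simp: in_Lp_def)
  show "(\<lambda>w. u w - v w) \<in> borel_measurable \<mu>" by measurable
  have "integrable \<mu> (\<lambda>w. 2 powr p * (\<bar>u w\<bar> powr p + \<bar>v w\<bar> powr p))"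
    using u v by (simp add: in_Lp_def)
  then show "integrable \<mu> (\<lambda>w. \<bar>u w - v w\<bar> powr p)"
  proof (rule integrable_dominated)
    fix w
    have "\<bar>u w - v w\<bar> powr p \<le> (2 * max \<bar>u w\<bar> \<bar>v w\<bar>) powr p"
      using p by (intro powr_mono2) auto
    also have "\<dots> = 2 powr p * (max \<bar>u w\<bar> \<bar>v w\<bar>) powr p"
      by (simp add: powr_mult)
    also have "\<dots> \<le> 2 powr p * (\<bar>u w\<bar> powr p + \<bar>v w\<bar> powr p)"
      by (intro mult_left_mono) (simp_all add: max_def)
    finally show "\<bar>\<bar>u w - v w\<bar> powr p\<bar> \<le> 2 powr p * (\<bar>u w\<bar> powr p + \<bar>v w\<bar> powr p)" by simp
  qed measurable
qed

lemma in_Lp_wick: "in_Lp \<mu> p (\<E> h)"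
  using integrable_wick_powr[of h p] wick_pos[of h] by (simp add: in_Lp_def less_imp_le)

section \<open>The Wick product with a Wick exponential\<close>

text \<open>Two candidates may come with different exponents. On a probability space the smaller
  one, still above \<open>1\<close>, serves both, and totality applies to the difference.\<close>

lemma wick_candidate_unique:
  assumes "wick_candidate \<iota> \<mu> u v z" "wick_candidate \<iota> \<mu> u v z'"
  shows "AE w in \<mu>. z' w = z w"
proof -
  obtain r r' where r: "1 < r" "in_Lp \<mu> r z" "1 < r'" "in_Lp \<mu> r' z'"
    using assms by (auto simp: wick_candidate_def)
  define s where "s = min r r'"
  have s: "1 < s" "in_Lp \<mu> s z" "in_Lp \<mu> s z'"
    using r by (auto simp: s_def intro: in_Lp_mono)
  have "AE w in \<mu>. z' w - z w = 0"
  proof (rule wick_total[of s])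
    show "in_Lp \<mu> s (\<lambda>w. z' w - z w)" using s by (intro in_Lp_diff) auto
    fix h
    have "(\<integral>w. (z' w - z w) * \<E> h w \<partial>\<mu>) = (\<integral>w. z' w * \<E> h w \<partial>\<mu>) - (\<integral>w. z w * \<E> h w \<partial>\<mu>)"
      unfolding left_diff_distrib
      by (intro Bochner_Integration.integral_diff integrable_Lp_wick[OF _ s(1)] s)
    also have "\<dots> = 0" using assms by (simp add: wick_candidate_def)
    finally show "(\<integral>w. (z' w - z w) * \<E> h w \<partial>\<mu>) = 0" .
  qed (rule s)
  then show ?thesis by eventually_elim simp
qed

lemma is_wick_product_translate:
  assumes f: "in_Lp \<mu> p f" and p: "1 < p"
  shows "is_wick_product \<iota> \<mu> f (\<E> (- k)) (\<lambda>w. \<E> (- k) w * f (w + \<iota> k))"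
proof -
  have [measurable]: "f \<in> borel_measurable \<mu>" using f by (simp add: in_Lp_def)
  \<comment> \<open>Any exponent strictly between \<open>1\<close> and \<open>p\<close> would do;
    the midpoint is taken.\<close>
  have "in_Lp \<mu> ((1 + p) / 2) (\<lambda>w. \<E> (- k) w * f (w + \<iota> k))"
    using p by (intro in_Lp_translate[OF f]) auto
  then have "\<exists>r>1. in_Lp \<mu> r (\<lambda>w. \<E> (- k) w * f (w + \<iota> k))"
    using p by (intro exI[of _ "(1 + p) / 2"]) auto
  moreover have "(\<integral>w. \<E> (- k) w * f (w + \<iota> k) * \<E> h w \<partial>\<mu>)
      = (\<integral>w. f w * \<E> h w \<partial>\<mu>) * (\<integral>w. \<E> (- k) w * \<E> h w \<partial>\<mu>)" for h
  proof -
    \<comment> \<open>Rewriting \<open>w\<close> as \<open>w + \<iota> k - \<iota> k\<close> makes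
      everything beside the weight a function of \<open>w + \<iota> k\<close>, as the change of
      variables requires.\<close>
    have "(\<integral>w. \<E> (- k) w * f (w + \<iota> k) * \<E> h w \<partial>\<mu>)
        = (\<integral>w. \<E> (- k) w * (f (w + \<iota> k) * \<E> h (w + \<iota> k - \<iota> k)) \<partial>\<mu>)"
      by (simp add: mult.assoc)
    also have "\<dots> = (\<integral>w. f w * \<E> h (w - \<iota> k) \<partial>\<mu>)"
      by (rule integral_translate[of "\<lambda>w. f w * \<E> h (w - \<iota> k)"]) measurable
    also have "\<dots> = (\<integral>w. f w * \<E> h w * exp (- inner h k) \<partial>\<mu>)"
    proof (rule integral_cong_AE)
      show "AE w in \<mu>. f w * \<E> h (w - \<iota> k) = f w * \<E> h w * exp (- inner h k)"
        using wick_translate[of h k] by eventually_elim simp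
    qed measurable
    finally show ?thesis by (simp add: integral_wick_wick)
  qed
  ultimately have candidate: "wick_candidate \<iota> \<mu> f (\<E> (- k)) (\<lambda>w. \<E> (- k) w * f (w + \<iota> k))"
    by (simp add: wick_candidate_def)
  show ?thesis
    unfolding is_wick_product_def
  proof (intro conjI allI impI candidate)
    show "\<exists>r>1. in_Lp \<mu> r f" using f p by auto
    show "\<exists>r>1. in_Lp \<mu> r (\<E> (- k))" by (intro exI[of _ 2]) (simp add: in_Lp_wick)
  qed (rule wick_candidate_unique[OF candidate])
qed

section \<open>Law and mean of the random variable\<close>

lemma has_law_density_translate:
  assumes law: "has_law_density M X \<mu> f"
  shows "has_law_density M (\<lambda>\<omega>. X \<omega> - \<iota> k) \<mu> (\<lambda>w. \<E> (- k) w * f (w + \<iota> k))"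
proof -
  have [measurable]: "f \<in> borel_measurable \<mu>" "X \<in> measurable M \<mu>"
    and X: "distr M \<mu> X = density \<mu> (\<lambda>w. ennreal (f w))" and pos: "AE w in \<mu>. 0 \<le> f w"
    using law by (auto simp: has_law_density_def distributed_def)
  have "distr M \<mu> (\<lambda>\<omega>. X \<omega> - \<iota> k) = distr (distr M \<mu> X) \<mu> (\<lambda>w. w - \<iota> k)"
    by (subst distr_distr) (simp_all add: o_def)
  also have "\<dots> = density \<mu> (\<lambda>w. ennreal (\<E> (- k) w * f (w + \<iota> k)))"
    unfolding X
  proof (rule measure_eqI)
    fix A assume "A \<in> sets (distr (density \<mu> (\<lambda>w. ennreal (f w))) \<mu> (\<lambda>w. w - \<iota> k))"
    then have [measurable]: "A \<in> sets \<mu>" by simp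
    have "emeasure (distr (density \<mu> (\<lambda>w. ennreal (f w))) \<mu> (\<lambda>w. w - \<iota> k)) A
        = (\<integral>\<^sup>+w. indicator A w \<partial>distr (density \<mu> (\<lambda>w. ennreal (f w))) \<mu> (\<lambda>w. w - \<iota> k))"
      by simp
    also have "\<dots> = (\<integral>\<^sup>+w. indicator A (w - \<iota> k) \<partial>density \<mu> (\<lambda>w. ennreal (f w)))"
      by (rule nn_integral_distr) simp_all
    also have "\<dots> = (\<integral>\<^sup>+w. ennreal (f w) * indicator A (w - \<iota> k) \<partial>\<mu>)"
      by (rule nn_integral_density) measurable
    also have "\<dots> = (\<integral>\<^sup>+w. ennreal (\<E> (- k) w) * (ennreal (f (w + \<iota> k)) * indicator A (w + \<iota> k - \<iota> k)) \<partial>\<mu>)"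
      by (rule nn_integral_translate[symmetric]) measurable
    also have "\<dots> = (\<integral>\<^sup>+w. ennreal (\<E> (- k) w * f (w + \<iota> k)) * indicator A w \<partial>\<mu>)"
      by (simp add: ennreal_mult' wick_pos less_imp_le mult.assoc)
    also have "\<dots> = emeasure (density \<mu> (\<lambda>w. ennreal (\<E> (- k) w * f (w + \<iota> k)))) A"
      by (rule emeasure_density[symmetric]) measurable
    finally show "emeasure (distr (density \<mu> (\<lambda>w. ennreal (f w))) \<mu> (\<lambda>w. w - \<iota> k)) A
        = emeasure (density \<mu> (\<lambda>w. ennreal (\<E> (- k) w * f (w + \<iota> k)))) A" .
  qed simp
  finally have "distributed M \<mu> (\<lambda>\<omega>. X \<omega> - \<iota> k) (\<lambda>w. ennreal (\<E> (- k) w * f (w + \<iota> k)))"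
    unfolding distributed_def by simp
  \<comment> \<open>Nonnegativity of \<open>f\<close> is known only almost everywhere, so it is
    shifted by quasi-invariance, with \<open>- k\<close> because the argument is
    \<open>w + \<iota> k\<close>.\<close>
  moreover have "AE w in \<mu>. 0 \<le> \<E> (- k) w * f (w + \<iota> k)"
    using AE_translate[OF pos, of "- k"]
  proof eventually_elim
    fix w assume "0 \<le> f (w - \<iota> (- k))"
    then show "0 \<le> \<E> (- k) w * f (w + \<iota> k)"
      using linear_neg[OF bounded_linear.linear[OF embedding_bounded_linear], of k]
      by (simp add: wick_pos less_imp_le)
  qed
  ultimately show ?thesis by (simp add: has_law_density_def)
qed

text \<open>Evaluated at \<open>dual_emb \<iota> \<phi>\<close>, the defining equation of the kernel
  becomes the weak-mean equation for \<phi>, integrability included. Uniqueness holds because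
  functionals separate the points of \<open>W\<close>.\<close>

lemma is_expectation_first_kernel:
  assumes law: "has_law_density M X \<mu> f" and k: "is_first_kernel \<iota> \<mu> f k"
  shows "is_expectation M X (\<iota> k)"
proof -
  have [measurable]: "f \<in> borel_measurable \<mu>" "X \<in> measurable M \<mu>"
    and X: "distr M \<mu> X = density \<mu> (\<lambda>w. ennreal (f w))" and pos: "AE w in \<mu>. 0 \<le> f w"
    using law by (auto simp: has_law_density_def distributed_def)
  have eq: "AE w in \<mu>. \<delta> (dual_emb \<iota> \<phi>) w * f w = f w * blinfun_apply \<phi> w" for \<phi>
    using wiener_dual_emb[of \<phi>] by eventually_elim simp
  have mean: "weak_mean M X (\<iota> k)"
    unfolding weak_mean_def
  proof (intro allI conjI)
    fix \<phi> :: "'w \<Rightarrow>\<^sub>L real"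
    have int: "integrable \<mu> (\<lambda>w. \<delta> (dual_emb \<iota> \<phi>) w * f w)"
      and val: "(\<integral>w. \<delta> (dual_emb \<iota> \<phi>) w * f w \<partial>\<mu>) = inner k (dual_emb \<iota> \<phi>)"
      using k by (auto simp: is_first_kernel_def)
    have "integrable \<mu> (\<lambda>w. f w * blinfun_apply \<phi> w)"
      by (rule integrable_cong_AE_imp[OF int _ eq]) measurable
    then have "integrable (distr M \<mu> X) (blinfun_apply \<phi>)"
      unfolding X using pos by (simp add: integrable_density)
    then show "integrable M (\<lambda>\<omega>. blinfun_apply \<phi> (X \<omega>))"
      by (simp add: integrable_distr_eq)
    have "(\<integral>\<omega>. blinfun_apply \<phi> (X \<omega>) \<partial>M) = (\<integral>w. blinfun_apply \<phi> w \<partial>distr M \<mu> X)"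
      by (rule integral_distr[symmetric]) measurable
    also have "\<dots> = (\<integral>w. f w * blinfun_apply \<phi> w \<partial>\<mu>)"
      unfolding X by (subst integral_density) (simp_all add: pos)
    also have "\<dots> = (\<integral>w. \<delta> (dual_emb \<iota> \<phi>) w * f w \<partial>\<mu>)"
      by (rule integral_cong_AE[OF _ _ eq, symmetric]) measurable
    finally show "(\<integral>\<omega>. blinfun_apply \<phi> (X \<omega>) \<partial>M) = blinfun_apply \<phi> (\<iota> k)"
      unfolding val inner_dual_emb .
  qed
  moreover have "m = \<iota> k" if m: "weak_mean M X m" for m
  proof (rule blinfun_eq_on_imp_eq)
    fix \<phi> :: "'w \<Rightarrow>\<^sub>L real"
    have "(\<integral>\<omega>. blinfun_apply \<phi> (X \<omega>) \<partial>M) = blinfun_apply \<phi> m"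
      using m unfolding weak_mean_def by blast
    moreover have "(\<integral>\<omega>. blinfun_apply \<phi> (X \<omega>) \<partial>M) = blinfun_apply \<phi> (\<iota> k)"
      using mean unfolding weak_mean_def by blast
    ultimately show "blinfun_apply \<phi> m = blinfun_apply \<phi> (\<iota> k)" by simp
  qed
  ultimately show ?thesis unfolding is_expectation_def by blast
qed

end

theorem theorem3p4:
  fixes \<mu> :: "'w::banach measure"
    and \<iota> :: "'h::{real_inner, polish_space} \<Rightarrow> 'w"
    and M :: "'a measure"
    and X :: "'a \<Rightarrow> 'w"
    and f :: "'w \<Rightarrow> real"
    and p :: real
  assumes "abstract_wiener_space \<mu> \<iota>"
    and "prob_space M"
    and "X \<in> borel_measurable M"
    and "absolutely_continuous \<mu> (distr M \<mu> X)"
    and "has_law_density M X \<mu> f"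
    and "p > 1"
    and "in_Lp \<mu> p f"
  shows "\<exists>f1 :: 'h.
           is_first_kernel \<iota> \<mu> f f1 \<and>
           is_expectation M X (\<iota> f1) \<and>
           absolutely_continuous \<mu> (distr M \<mu> (\<lambda>\<omega>. X \<omega> - \<iota> f1)) \<and>
           (\<exists>g. is_wick_product \<iota> \<mu> f (wick_exp \<iota> \<mu> (- f1)) g \<and>
                has_law_density M (\<lambda>\<omega>. X \<omega> - \<iota> f1) \<mu> g \<and>
                (\<forall>q. 1 \<le> q \<and> q < p \<longrightarrow> in_Lp \<mu> q g))"
proof -
  interpret abstract_wiener_space \<mu> \<iota> by fact
  obtain k where k: "is_first_kernel \<iota> \<mu> f k"
    using ex_first_kernel[OF assms(7,6)] by blast
  let ?g = "\<lambda>w. wick_exp \<iota> \<mu> (- k) w * f (w + \<iota> k)"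
  have law: "has_law_density M (\<lambda>\<omega>. X \<omega> - \<iota> k) \<mu> ?g"
    by (rule has_law_density_translate[OF assms(5)])
  then have "distr M \<mu> (\<lambda>\<omega>. X \<omega> - \<iota> k) = density \<mu> (\<lambda>w. ennreal (?g w))"
    "(\<lambda>w. ennreal (?g w)) \<in> borel_measurable \<mu>"
    by (auto simp: has_law_density_def distributed_def)
  then have ac: "absolutely_continuous \<mu> (distr M \<mu> (\<lambda>\<omega>. X \<omega> - \<iota> k))"
    by (simp add: absolutely_continuousI_density)
  show ?thesis
  proof (intro exI conjI allI impI)
    show "is_first_kernel \<iota> \<mu> f k" by (rule k)
    show "is_expectation M X (\<iota> k)" by (rule is_expectation_first_kernel[OF assms(5) k])
    show "absolutely_continuous \<mu> (distr M \<mu> (\<lambda>\<omega>. X \<omega> - \<iota> k))" by (rule ac)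
    show "is_wick_product \<iota> \<mu> f (wick_exp \<iota> \<mu> (- k)) ?g"
      by (rule is_wick_product_translate[OF assms(7,6)])
    show "has_law_density M (\<lambda>\<omega>. X \<omega> - \<iota> k) \<mu> ?g" by (rule law)
    show "in_Lp \<mu> q ?g" if "1 \<le> q \<and> q < p" for q
      using that by (intro in_Lp_translate[OF assms(7)]) simp_all
  qed
qed

end
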